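(* Let $m\geq 2$, let $\mathbb{B}\subset\mathbb{R}^{2m}$ be the open unit ball with the standard symplectic form $\omega=\sum_{i=1}^m dx_i\wedge dy_i$ and its primitive $\lambda=\frac12\sum_{i=1}^m(x_i\,dy_i-y_i\,dx_i)$, and let $L>0$ be given. Then for any $\varepsilon>0$ there exist a positive integer $n$ and a compactly supported isotopy $\{\varphi^t\}_{t\in[0,1]}\subset\mathrm{Diff}_c(\mathbb{B},\omega)$ such that $\varphi^0=\mathrm{id}$ and the following hold. (b1) $\sigma_{\varphi^t,\lambda}\geq -L+L/n$ for all $t\in[0,1]$. (b2) $\mathrm{CAL}(\varphi^1)+L\pi^m\leq\varepsilon$. (b3) All the fixed points of $\varphi^1$ have non-negative action, i.e. $\sigma_{\varphi^1,\lambda}(z)\ge 0$ whenever $\varphi^1(z)=z$. (b4) All the periodic points of $\varphi^1$ that are not fixed points have period at least $n$.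
   Context: $\mathrm{Diff}_c(\mathbb{B},\omega)$ denotes the group of compactly supported symplectomorphisms of $(\mathbb{B},\omega)$. For $\varphi\in\mathrm{Diff}_c(\mathbb{B},\omega)$, the action of $\varphi$ is the unique function $\sigma_{\varphi,\lambda}:\mathbb{B}\to\mathbb{R}$ satisfying $$d\sigma_{\varphi,\lambda}=\varphi^*\lambda-\lambda\quad\text{and}\quad\sigma_{\varphi,\lambda}=0\ \text{near}\ \partial\mathbb{B}.$$ The Calabi invariant of $\varphi$ is $$\mathrm{CAL}(\varphi):=\int_{\mathbb{B}}\sigma_{\varphi,\lambda}\,\omega^m.$$ An isotopy here is a path that is smooth in $(t,z)$. *)

theory Defs
  imports "HOL-Analysis.Analysis" "HOL-Combinatorics.Combinatorics"
begin

section \<open>Smooth maps\<close>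

text \<open>
  \<open>Ck_on k S f\<close> is the usual notion of a \<open>k\<close> times continuously differentiable map when \<open>S\<close> is
  open; it is only used for such \<open>S\<close>.
\<close>

primrec Ck_on ::
  "nat \<Rightarrow> 'a::real_normed_vector set \<Rightarrow> ('a \<Rightarrow> 'b::real_normed_vector) \<Rightarrow> bool" where
  "Ck_on 0 S f \<longleftrightarrow> continuous_on S f"
| "Ck_on (Suc k) S f \<longleftrightarrow>
     (\<forall>x\<in>S. f differentiable (at x)) \<and> (\<forall>v. Ck_on k S (\<lambda>x. frechet_derivative f (at x) v))"

text \<open>
  Smoothness on an arbitrary set such as \<open>[0,1] \<times> B\<close> means that, locally, there is a smooth
  extension to an open set.  On open sets this is ordinary smoothness.
\<close>

definition smooth_on :: "'a::real_normed_vector set \<Rightarrow> ('a \<Rightarrow> 'b::real_normed_vector) \<Rightarrow> bool" where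
  "smooth_on S f \<longleftrightarrow>
     (\<forall>p\<in>S. \<exists>U g. open U \<and> p \<in> U \<and> (\<forall>k. Ck_on k U g) \<and> (\<forall>x\<in>S \<inter> U. g x = f x))"

section \<open>The symplectic unit ball\<close>

text \<open>
  A point of \<open>\<real>\<^sup>2\<^sup>m\<close> is a pair \<open>(x, y)\<close> of vectors in \<open>\<real>\<^sup>m\<close>, with \<open>m = CARD('n)\<close>.  The norm of the
  product type is the Euclidean one and \<open>lborel\<close> is Lebesgue measure.
\<close>

type_synonym 'n phase = "(real^'n) \<times> (real^'n)"

abbreviation unit_ball :: "'n::finite phase set" where
  "unit_ball \<equiv> ball 0 1"

definition symplectic_form :: "'n::finite phase \<Rightarrow> 'n phase \<Rightarrow> real" where
  "symplectic_form u v = (\<Sum>i\<in>UNIV. fst u $ i * snd v $ i - snd u $ i * fst v $ i)"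

text \<open>The 1-form \<open>1/2 \<Sum> (x\<^sub>i dy\<^sub>i - y\<^sub>i dx\<^sub>i)\<close>; the first argument is the base point.\<close>

definition liouville_form :: "'n::finite phase \<Rightarrow> 'n phase \<Rightarrow> real" where
  "liouville_form z v = 1/2 * (\<Sum>i\<in>UNIV. fst z $ i * snd v $ i - snd z $ i * fst v $ i)"

text \<open>
  The top exterior power \<open>\<omega>\<^sup>m\<close>, evaluated on \<open>2m\<close> vectors indexed by \<open>'n \<times> bool\<close>.  It is the wedge
  product \<open>\<omega> \<and> \<dots> \<and> \<omega>\<close> in the convention
  \<open>(\<alpha> \<and> \<beta>)(v\<^sub>1, \<dots>) = 1/(k! l!) \<Sum>\<^sub>p sign p \<alpha>(v\<^sub>p\<^sub>1, \<dots>, v\<^sub>p\<^sub>k) \<beta>(\<dots>)\<close>, where for \<open>m\<close> factors of degree \<open>2\<close>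
  the normalisation is \<open>1/2\<^sup>m\<close>.  As the factors have even degree, no ordering of \<open>'n\<close> is needed.
\<close>

definition symplectic_volume_form :: "('n::finite \<times> bool \<Rightarrow> 'n phase) \<Rightarrow> real" where
  "symplectic_volume_form v =
     1 / 2 ^ CARD('n) *
     (\<Sum>p | p permutes UNIV.
        of_int (sign p) * (\<Prod>i\<in>UNIV. symplectic_form (v (p (i, False))) (v (p (i, True)))))"

text \<open>The frame \<open>\<partial>/\<partial>x\<^sub>i\<close> (at \<open>(i, False)\<close>), \<open>\<partial>/\<partial>y\<^sub>i\<close> (at \<open>(i, True)\<close>).\<close>

definition coordinate_frame :: "'n::finite \<times> bool \<Rightarrow> 'n phase" where
  "coordinate_frame = (\<lambda>(i, b). if b then (0, axis i 1) else (axis i 1, 0))"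

section \<open>Compactly supported symplectomorphisms\<close>

definition pullback_1form ::
  "('n::finite phase \<Rightarrow> 'n phase) \<Rightarrow> ('n phase \<Rightarrow> 'n phase \<Rightarrow> real) \<Rightarrow> 'n phase \<Rightarrow> 'n phase \<Rightarrow> real" where
  "pullback_1form \<phi> \<alpha> z v = \<alpha> (\<phi> z) (frechet_derivative \<phi> (at z) v)"

definition symplectic_on_ball :: "('n::finite phase \<Rightarrow> 'n phase) \<Rightarrow> bool" where
  "symplectic_on_ball \<phi> \<longleftrightarrow>
     (\<forall>z\<in>unit_ball. \<forall>u v.
        symplectic_form (frechet_derivative \<phi> (at z) u) (frechet_derivative \<phi> (at z) v)
        = symplectic_form u v)"

text \<open>
  The group \<open>Diff\<^sub>c(B, \<omega>)\<close>.  Its elements are maps of \<open>B\<close>, represented by total functions whose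
  values outside \<open>B\<close> are irrelevant.
\<close>

definition Diff_c :: "('n::finite phase \<Rightarrow> 'n phase) set" where
  "Diff_c = {\<phi>. bij_betw \<phi> unit_ball unit_ball
                \<and> smooth_on unit_ball \<phi>
                \<and> smooth_on unit_ball (inv_into unit_ball \<phi>)
                \<and> symplectic_on_ball \<phi>
                \<and> (\<exists>K. compact K \<and> K \<subseteq> unit_ball \<and> (\<forall>z\<in>unit_ball - K. \<phi> z = z))}"

text \<open>
  Isotopies in \<open>Diff\<^sub>c(B, \<omega>)\<close>, smooth in \<open>(t, z)\<close>; compactly supported means that one compact
  subset of \<open>B\<close> contains the supports of all the maps.
\<close>

definition compactly_supported_isotopy :: "(real \<Rightarrow> 'n::finite phase \<Rightarrow> 'n phase) \<Rightarrow> bool" where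
  "compactly_supported_isotopy \<phi> \<longleftrightarrow>
     (\<forall>t\<in>{0..1}. \<phi> t \<in> Diff_c)
     \<and> smooth_on ({0..1} \<times> unit_ball) (\<lambda>(t, z). \<phi> t z)
     \<and> (\<exists>K. compact K \<and> K \<subseteq> unit_ball \<and> (\<forall>t\<in>{0..1}. \<forall>z\<in>unit_ball - K. \<phi> t z = z))"

section \<open>Action and Calabi invariant\<close>

text \<open>
  The last clause only normalises the total function representing \<open>\<sigma> : B \<rightarrow> \<real>\<close>, so that it is
  determined by its values on \<open>B\<close>.
\<close>

definition is_action :: "('n::finite phase \<Rightarrow> 'n phase) \<Rightarrow> ('n phase \<Rightarrow> real) \<Rightarrow> bool" where
  "is_action \<phi> \<sigma> \<longleftrightarrow>
     (\<forall>z\<in>unit_ball.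
        (\<sigma> has_derivative (\<lambda>v. pullback_1form \<phi> liouville_form z v - liouville_form z v)) (at z))
     \<and> (\<exists>U. open U \<and> frontier unit_ball \<subseteq> U \<and> (\<forall>z\<in>U \<inter> unit_ball. \<sigma> z = 0))
     \<and> (\<forall>z. z \<notin> unit_ball \<longrightarrow> \<sigma> z = 0)"

definition action :: "('n::finite phase \<Rightarrow> 'n phase) \<Rightarrow> 'n phase \<Rightarrow> real" where
  "action \<phi> = (THE \<sigma>. is_action \<phi> \<sigma>)"

lemma is_action_unique:
  assumes "is_action \<phi> \<sigma>" "is_action \<phi> \<tau>"
  shows "\<sigma> = \<tau>"
proof -
  let ?B = "unit_ball :: 'a phase set"
  obtain U where U: "open U" "frontier ?B \<subseteq> U" "\<And>z. z \<in> U \<inter> ?B \<Longrightarrow> \<sigma> z = 0"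
    using assms(1) unfolding is_action_def by blast
  obtain V where V: "open V" "frontier ?B \<subseteq> V" "\<And>z. z \<in> V \<inter> ?B \<Longrightarrow> \<tau> z = 0"
    using assms(2) unfolding is_action_def by blast
  obtain b :: "'a phase" where b: "b \<in> Basis"
    using nonempty_Basis by blast
  have fr: "b \<in> frontier ?B"
    using b by (simp add: frontier_ball)
  then have "b \<in> closure ?B" "open (U \<inter> V)" "b \<in> U \<inter> V"
    using U V by (auto simp: frontier_def)
  then obtain w where w: "w \<in> ?B" "w \<in> U \<inter> V"
    by (meson closure_iff_nhds_not_empty disjoint_iff subset_refl)
  have "\<exists>c. \<forall>z\<in>?B. \<sigma> z - \<tau> z = c"
  proof -
    have d: "((\<lambda>z. \<sigma> z - \<tau> z) has_derivative (\<lambda>h. 0)) (at z within ?B)" if "z \<in> ?B" for z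
    proof -
      let ?D = "\<lambda>v. pullback_1form \<phi> liouville_form z v - liouville_form z v"
      have "(\<sigma> has_derivative ?D) (at z)" "(\<tau> has_derivative ?D) (at z)"
        using assms that by (auto simp: is_action_def)
      from has_derivative_diff[OF this] show ?thesis
        by (auto intro: has_derivative_at_withinI)
    qed
    show ?thesis
      using has_derivative_zero_constant[OF convex_ball d] by blast
  qed
  with w U V have "\<forall>z\<in>?B. \<sigma> z - \<tau> z = 0"
    by (metis Int_iff diff_self)
  then show ?thesis
    using assms by (intro ext) (metis eq_iff_diff_eq_0 is_action_def)
qed

text \<open>
  The integral of the \<open>2m\<close>-form \<open>\<sigma> \<omega>\<^sup>m\<close> over \<open>B\<close> in the coordinates
  \<open>(x\<^sub>1, y\<^sub>1, \<dots>, x\<^sub>m, y\<^sub>m)\<close>, which are positively oriented for \<open>\<omega>\<^sup>m\<close>.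
\<close>

definition CAL :: "('n::finite phase \<Rightarrow> 'n phase) \<Rightarrow> real" where
  "CAL \<phi> =
     (LINT z:unit_ball|lborel.
        action \<phi> z * symplectic_volume_form (coordinate_frame :: 'n \<times> bool \<Rightarrow> 'n phase))"

section \<open>Periodic points\<close>

text \<open>The (minimal) period of a periodic point is \<open>least_power\<close> from the library.\<close>

definition periodic_point :: "('a \<Rightarrow> 'a) \<Rightarrow> 'a \<Rightarrow> bool" where
  "periodic_point f z \<longleftrightarrow> (\<exists>k>0. (f ^^ k) z = z)"

end

theory Submission
  imports Defs
begin

text \<open>
  Write \<open>R\<close> for the rotation of all complex coordinates by \<open>2\<pi>/n\<close>.  A rotation by an angle depending on
  \<open>|z|\<^sup>2\<close>, equal to \<open>R\<close> away from the boundary and decreasing to the identity there, has action in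
  \<open>[0, \<pi>/n]\<close> and no periodic points of period less than \<open>n\<close> except fixed points.  The sector
  \<open>0 < arg z\<^sub>1 < 2\<pi>/n\<close> is a fundamental domain of \<open>R\<close>; by Vitali's covering theorem it is filled, up to small
  measure, by finitely many small disjoint balls, and the images of these balls under the powers of \<open>R\<close>
  nearly fill the unit ball.  The rotation is composed with a map that turns each of these balls about its
  centre, again by an angle depending only on the distance to the centre; on a ball of radius \<open>a\<close> an angle
  of about \<open>-2L/a\<^sup>2\<close> produces an action close to \<open>-L\<close> on most of the ball and never much below.
  The composition moves every ball of the packing to its image under \<open>R\<close>, so it has no fixed points there
  and all periods of points in the balls are at least \<open>n\<close>, while outside the balls it is the first rotation.
\<close>

section \<open>Smooth maps defined everywhere\<close>

text \<open>The ball has volume pi^m/m! and omega^m is m! times Lebesgue measure, so a Calabi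
  invariant near -L pi^m together with the bound -L forces an action near -L almost everywhere,
  whereas fixed points must not have negative action. Twisting small balls alone fails: each centre
  would be fixed with action near -L. Composing with R displaces the centres at little cost, since
  actions add along a composition and the action of the global rotation is at most pi/n. The angle
  -2L/a^2 arises because a rigid turn by a fixed angle, cut off near radius a, has action about that
  angle times a^2/2. A twist centred at c rather than at the origin has an extra action term,
  because lambda is not translation invariant; it is bounded by a, which is why the balls must be
  small. The margin L/n in (b1) pays for it: the twists are built for L - L/n - 1/n and radii at
  most 1/n. Only finitely many balls are used, so that all supports stay in one compact
  subset.\<close>

lemma Ck_on_SucI:
  assumes "\<And>x. (f has_derivative f' x) (at x)" "\<And>v. Ck_on k UNIV (\<lambda>x. f' x v)"
  shows "Ck_on (Suc k) UNIV f"
proof -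
  have "frechet_derivative f (at x) = f' x" for x
    using assms(1) frechet_derivative_at by metis
  with assms show ?thesis
    by (auto simp: differentiable_def)
qed

lemma Ck_on_SucD:
  assumes "Ck_on (Suc k) UNIV f"
  shows "(f has_derivative frechet_derivative f (at x)) (at x)"
    "Ck_on k UNIV (\<lambda>x. frechet_derivative f (at x) v)"
  using assms by (auto simp: frechet_derivative_works)

text \<open>Product and chain rule leave undifferentiated factors in the derivative; the inductions
  over the order need their regularity one order down.\<close>

lemma Ck_on_Suc_imp: "Ck_on (Suc k) UNIV f \<Longrightarrow> Ck_on k UNIV f"
proof (induction k arbitrary: f)
  case 0
  then show ?case
    by (auto simp: differentiable_on_def intro!: differentiable_imp_continuous_on)
next
  case (Suc k)
  then show ?case
    by (metis Ck_on.simps(2))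
qed

lemma Ck_on_const: "Ck_on k UNIV (\<lambda>x. c)"
  by (induction k arbitrary: c) (auto simp: frechet_derivative_const)

lemma Ck_on_bounded_linear_comp:
  assumes "bounded_linear h" "Ck_on k UNIV f"
  shows "Ck_on k UNIV (\<lambda>x. h (f x))"
  using assms(2)
proof (induction k arbitrary: f)
  case 0
  then show ?case
    using bounded_linear.continuous_on[OF assms(1)] by auto
next
  case (Suc k)
  show ?case
    by (rule Ck_on_SucI[OF bounded_linear.has_derivative[OF assms(1)]])
       (use Ck_on_SucD[OF Suc.prems] Suc.IH in auto)
qed

lemma Ck_on_add:
  assumes "Ck_on k UNIV f" "Ck_on k UNIV g"
  shows "Ck_on k UNIV (\<lambda>x. f x + g x)"
  using assms
proof (induction k arbitrary: f g)
  case 0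
  then show ?case by (auto intro: continuous_intros)
next
  case (Suc k)
  show ?case
    by (rule Ck_on_SucI[OF has_derivative_add])
       (use Ck_on_SucD[OF Suc.prems(1)] Ck_on_SucD[OF Suc.prems(2)] Suc.IH in auto)
qed

lemma Ck_on_bilinear:
  assumes "bounded_bilinear h" "Ck_on k UNIV f" "Ck_on k UNIV g"
  shows "Ck_on k UNIV (\<lambda>x. h (f x) (g x))"
  using assms(2,3)
proof (induction k arbitrary: f g)
  case 0
  then show ?case
    using bounded_bilinear.continuous_on[OF assms(1)] by auto
next
  case (Suc k)
  show ?case
    by (rule Ck_on_SucI[OF bounded_bilinear.FDERIV[OF assms(1)]])
       (use Ck_on_SucD[OF Suc.prems(1)] Ck_on_SucD[OF Suc.prems(2)] Suc.IH
          Ck_on_Suc_imp[OF Suc.prems(1)] Ck_on_Suc_imp[OF Suc.prems(2)]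
          in \<open>auto intro!: Ck_on_add\<close>)
qed

lemma Ck_on_sum:
  "(\<And>i. i \<in> I \<Longrightarrow> Ck_on k UNIV (f i)) \<Longrightarrow> Ck_on k UNIV (\<lambda>x. \<Sum>i\<in>I. f i x)"
  by (induction I rule: infinite_finite_induct) (auto intro: Ck_on_const Ck_on_add)

text \<open>The recursion of \<open>Ck_on\<close> controls derivatives only in fixed directions,
  while the chain rule evaluates Dg in the moving direction Df(x) v. Expanding that direction in a
  basis leaves finitely many products of admissible functions; hence the Euclidean intermediate
  space.\<close>

lemma Ck_on_compose:
  fixes f :: "'a::real_normed_vector \<Rightarrow> 'b::euclidean_space"
    and g :: "'b \<Rightarrow> 'c::real_normed_vector"
  assumes "Ck_on k UNIV g" "Ck_on k UNIV f"
  shows "Ck_on k UNIV (\<lambda>x. g (f x))"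
  using assms
proof (induction k arbitrary: g)
  case 0
  then show ?case
    by (auto intro: continuous_on_compose2)
next
  case (Suc k)
  note g = Ck_on_SucD[OF Suc.prems(1)] and f = Ck_on_SucD[OF Suc.prems(2)]
  have eq: "frechet_derivative g (at (f x)) (frechet_derivative f (at x) v) =
     (\<Sum>b\<in>Basis. (frechet_derivative f (at x) v \<bullet> b) *\<^sub>R frechet_derivative g (at (f x)) b)" for x v
  proof -
    have lin: "linear (frechet_derivative g (at (f x)))"
      using g(1) has_derivative_linear by blast
    show ?thesis
      by (subst euclidean_representation[symmetric, of "frechet_derivative f (at x) v"])
         (simp add: linear_sum[OF lin] linear_cmul[OF lin])
  qed
  show ?case
  proof (rule Ck_on_SucI)
    show "((\<lambda>x. g (f x)) has_derivative
        (\<lambda>v. frechet_derivative g (at (f x)) (frechet_derivative f (at x) v))) (at x)" for x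
      using diff_chain_at[OF f(1) g(1), of x] by (simp add: o_def)
    show "Ck_on k UNIV (\<lambda>x. frechet_derivative g (at (f x)) (frechet_derivative f (at x) v))" for v
      unfolding eq
      by (intro Ck_on_sum Ck_on_bilinear[OF bounded_bilinear_scaleR]
            Ck_on_bounded_linear_comp[OF bounded_linear_inner_left]
            f(2) Suc.IH g(2) Ck_on_Suc_imp[OF Suc.prems(2)])
  qed
qed

definition smooth :: "('a::real_normed_vector \<Rightarrow> 'b::real_normed_vector) \<Rightarrow> bool" where
  "smooth f \<longleftrightarrow> (\<forall>k. Ck_on k UNIV f)"

named_theorems smooth_intros

lemma smooth_imp_smooth_on: "smooth f \<Longrightarrow> smooth_on S f"
  unfolding smooth_def smooth_on_def by blast

lemma smooth_const [smooth_intros]: "smooth (\<lambda>x. c)"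
  by (simp add: smooth_def Ck_on_const)

lemma smooth_bounded_linear: "bounded_linear h \<Longrightarrow> smooth f \<Longrightarrow> smooth (\<lambda>x. h (f x))"
  by (simp add: smooth_def Ck_on_bounded_linear_comp)

lemma smooth_ident [smooth_intros]: "smooth (\<lambda>x. x)"
  unfolding smooth_def
proof
  show "Ck_on k UNIV (\<lambda>x. x)" for k
    by (cases k) (use Ck_on_SucI[OF has_derivative_ident Ck_on_const] in auto)
qed

lemma smooth_add [smooth_intros]: "smooth f \<Longrightarrow> smooth g \<Longrightarrow> smooth (\<lambda>x. f x + g x)"
  by (simp add: smooth_def Ck_on_add)

lemma smooth_diff [smooth_intros]:
  assumes "smooth f" "smooth g"
  shows "smooth (\<lambda>x. f x - g x)"
  using smooth_add[OF assms(1) smooth_bounded_linear[OF bounded_linear_minus[OF bounded_linear_ident] assms(2)]]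
  by simp

lemma smooth_mult [smooth_intros]:
  fixes f g :: "_ \<Rightarrow> real"
  shows "smooth f \<Longrightarrow> smooth g \<Longrightarrow> smooth (\<lambda>x. f x * g x)"
  by (simp add: smooth_def Ck_on_bilinear[OF bounded_bilinear_mult])

lemma smooth_scaleR [smooth_intros]:
  "smooth f \<Longrightarrow> smooth g \<Longrightarrow> smooth (\<lambda>x. f x *\<^sub>R g x)"
  by (simp add: smooth_def Ck_on_bilinear[OF bounded_bilinear_scaleR])

lemma smooth_inner [smooth_intros]:
  "smooth f \<Longrightarrow> smooth g \<Longrightarrow> smooth (\<lambda>x. f x \<bullet> g x)"
  by (simp add: smooth_def Ck_on_bilinear[OF bounded_bilinear_inner])

lemma smooth_fst [smooth_intros]: "smooth f \<Longrightarrow> smooth (\<lambda>x. fst (f x))"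
  by (rule smooth_bounded_linear[OF bounded_linear_fst])

lemma smooth_snd [smooth_intros]: "smooth f \<Longrightarrow> smooth (\<lambda>x. snd (f x))"
  by (rule smooth_bounded_linear[OF bounded_linear_snd])

lemma smooth_Pair [smooth_intros]:
  assumes "smooth f" "smooth g"
  shows "smooth (\<lambda>x. (f x, g x))"
proof -
  have "bounded_linear (\<lambda>y. (y, 0))" "bounded_linear (Pair 0)"
    by (intro bounded_linear_Pair bounded_linear_ident bounded_linear_zero)+
  then have "smooth (\<lambda>x. (f x, 0) + (0, g x))"
    using assms by (intro smooth_add smooth_bounded_linear[of "\<lambda>y. (y, 0)" f] smooth_bounded_linear[of "Pair 0" g])
  then show ?thesis by simp
qed

lemma smooth_compose:
  fixes f :: "'a::real_normed_vector \<Rightarrow> 'b::euclidean_space"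
  shows "smooth g \<Longrightarrow> smooth f \<Longrightarrow> smooth (\<lambda>x. g (f x))"
  by (simp add: smooth_def Ck_on_compose)

lemma smooth_has_derivative:
  "smooth f \<Longrightarrow> (f has_derivative frechet_derivative f (at x)) (at x)"
  unfolding smooth_def using Ck_on_SucD(1) by blast

lemma smooth_imp_continuous_on: "smooth f \<Longrightarrow> continuous_on S f"
  unfolding smooth_def using Ck_on.simps(1) continuous_on_subset subset_UNIV by blast

lemma Ck_on_Suc_real:
  fixes f :: "real \<Rightarrow> real"
  assumes "\<And>x. (f has_real_derivative f' x) (at x)" "Ck_on k UNIV f'"
  shows "Ck_on (Suc k) UNIV f"
  by (rule Ck_on_SucI[OF assms(1)[unfolded has_field_derivative_def]])
     (use Ck_on_bilinear[OF bounded_bilinear_mult assms(2) Ck_on_const] in simp)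

lemma smooth_real:
  fixes f :: "real \<Rightarrow> real"
  assumes "\<And>x. (f has_real_derivative f' x) (at x)" "smooth f'"
  shows "smooth f"
  unfolding smooth_def
proof
  show "Ck_on k UNIV f" for k
    by (rule Ck_on_Suc_imp, rule Ck_on_Suc_real) (use assms smooth_def in auto)
qed

lemma Ck_on_sin_cos:
  "Ck_on k UNIV (sin :: real \<Rightarrow> real) \<and> Ck_on k UNIV (cos :: real \<Rightarrow> real)"
proof (induction k)
  case 0
  show ?case by (simp add: continuous_on_sin continuous_on_cos)
next
  case (Suc k)
  have "Ck_on k UNIV (\<lambda>x::real. - sin x)"
    using Suc by (intro Ck_on_bounded_linear_comp[OF bounded_linear_minus[OF bounded_linear_ident]]) simp
  then show ?case
    using Suc Ck_on_Suc_real[OF DERIV_sin] Ck_on_Suc_real[OF DERIV_cos] by blast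
qed

lemma smooth_sin [smooth_intros]: "smooth f \<Longrightarrow> smooth (\<lambda>x. sin (f x :: real))"
  by (rule smooth_compose) (simp_all add: smooth_def Ck_on_sin_cos)

lemma smooth_cos [smooth_intros]: "smooth f \<Longrightarrow> smooth (\<lambda>x. cos (f x :: real))"
  by (rule smooth_compose) (simp_all add: smooth_def Ck_on_sin_cos)

section \<open>Smooth step functions\<close>

text \<open>The classical exp(-1/x) with a power of 1/x in front. Derivatives of members of this
  family are linear combinations of members, so one induction over the order proves all of them
  smooth.\<close>

definition flat_fun :: "nat \<Rightarrow> real \<Rightarrow> real" where
  "flat_fun j x = (if x \<le> 0 then 0 else (1 / x) ^ j * exp (- (1 / x)))"

lemma flat_fun_tendsto_0: "(flat_fun j \<longlongrightarrow> 0) (at_right 0)"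
proof -
  have "((\<lambda>x::real. x ^ j / exp x) \<longlongrightarrow> 0) at_top"
    by (rule tendsto_power_div_exp_0)
  then have "((\<lambda>x::real. inverse x ^ j / exp (inverse x)) \<longlongrightarrow> 0) (at_right 0)"
    by (rule filterlim_compose[OF _ filterlim_inverse_at_top_right])
  moreover have "eventually (\<lambda>x::real. inverse x ^ j / exp (inverse x) = flat_fun j x) (at_right 0)"
    using eventually_at_right_less
    by eventually_elim (simp add: flat_fun_def exp_minus divide_inverse)
  ultimately show ?thesis
    by (rule Lim_transform_eventually)
qed

lemma flat_fun_deriv:
  "(flat_fun j has_real_derivative flat_fun (j + 2) x - real j * flat_fun (j + 1) x) (at x)"
proof -
  consider "x < 0" | "x = 0" | "x > 0" by linarith
  then show ?thesis
  proof cases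
    case 1
    have ev: "eventually (\<lambda>y. (0::real) = flat_fun j y) (nhds x)"
      using eventually_nhds_in_open[of "{..<0}" x] 1
      by (auto elim!: eventually_mono simp: flat_fun_def)
    have "(flat_fun j has_real_derivative 0) (at x)"
      using DERIV_cong_ev[OF refl ev refl, THEN iffD1] by simp
    then show ?thesis
      using 1 by (simp add: flat_fun_def)
  next
    case 2
    have "((\<lambda>y. (flat_fun j y - flat_fun j 0) / (y - 0)) \<longlongrightarrow> 0) (at 0)"
      proof (rule filterlim_at_split[THEN iffD2], intro conjI)
      have "eventually (\<lambda>y. 0 = (flat_fun j y - flat_fun j 0) / (y - 0)) (at_left (0::real))"
        by (auto simp: eventually_at_filter flat_fun_def)
      then show "((\<lambda>y. (flat_fun j y - flat_fun j 0) / (y - 0)) \<longlongrightarrow> 0) (at_left 0)"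
        by (rule Lim_transform_eventually[OF tendsto_const])
      \<comment> \<open>To the right of 0 the difference quotient is again a member of the family,
        so the limit already proved gives derivative 0.\<close>
      have "eventually (\<lambda>y. flat_fun (Suc j) y = (flat_fun j y - flat_fun j 0) / (y - 0)) (at_right (0::real))"
        using eventually_at_right_less
        by eventually_elim (simp add: flat_fun_def)
      then show "((\<lambda>y. (flat_fun j y - flat_fun j 0) / (y - 0)) \<longlongrightarrow> 0) (at_right 0)"
        by (rule Lim_transform_eventually[OF flat_fun_tendsto_0])
    qed
    then show ?thesis
      using 2 by (simp add: has_field_derivative_iff flat_fun_def)
  next
    case 3
    have "((\<lambda>x. (1 / x) ^ j * exp (- (1 / x))) has_real_derivative
       (1 / x) ^ (j + 2) * exp (- (1 / x)) - real j * ((1 / x) ^ (j + 1) * exp (- (1 / x)))) (at x)"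
    proof -
      have "((\<lambda>x. 1 / x) has_real_derivative - (1 / x)\<^sup>2) (at x)"
        using 3 by (auto intro!: derivative_eq_intros simp: power2_eq_square)
      from DERIV_power[OF this, of j]
      have "((\<lambda>x. (1 / x) ^ j) has_real_derivative - real j * (1 / x) ^ (j + 1)) (at x)"
        by (rule DERIV_cong) (cases j, simp_all add: power2_eq_square divide_inverse algebra_simps)
      moreover have "((\<lambda>x. exp (- (1 / x))) has_real_derivative exp (- (1 / x)) * (1 / x)\<^sup>2) (at x)"
        using 3 by (auto intro!: derivative_eq_intros simp: power2_eq_square)
      ultimately show ?thesis
        by (rule DERIV_cong[OF DERIV_mult]) (simp add: algebra_simps power2_eq_square)
    qed
    moreover have "eventually (\<lambda>y. (1 / y) ^ j * exp (- (1 / y)) = flat_fun j y) (nhds x)"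
      using eventually_nhds_in_open[of "{0<..}" x] 3
      by (auto elim!: eventually_mono simp: flat_fun_def)
    ultimately show ?thesis
      using 3 by (subst DERIV_cong_ev[OF refl _ refl, symmetric]) (auto simp: flat_fun_def)
  qed
qed

lemma smooth_flat_fun: "smooth (flat_fun j)"
  unfolding smooth_def
proof
  show "Ck_on k UNIV (flat_fun j)" for k
  proof (induction k arbitrary: j)
    case 0
    show ?case
      using flat_fun_deriv by (auto intro!: continuous_at_imp_continuous_on DERIV_isCont)
  next
    case (Suc k)
    have "Ck_on k UNIV (\<lambda>x. flat_fun (j + 2) x + (- real j) * flat_fun (j + 1) x)"
      by (intro Ck_on_add Suc Ck_on_bilinear[OF bounded_bilinear_mult] Ck_on_const)
    then show ?case
      using Ck_on_Suc_real[OF flat_fun_deriv] by simp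
  qed
qed

lemma continuous_antiderivative:
  fixes f :: "real \<Rightarrow> real"
  assumes "continuous_on UNIV f"
  obtains F where "\<And>x. (F has_real_derivative f x) (at x)"
proof -
  have "\<exists>F. \<forall>x::real. -\<infinity> < ereal x \<longrightarrow> ereal x < \<infinity> \<longrightarrow> (F has_vector_derivative f x) (at x)"
    by (rule einterval_antiderivative) (use assms continuous_on_eq_continuous_at in auto)
  then show ?thesis
    using that by (auto simp: has_real_derivative_iff_has_vector_derivative)
qed

text \<open>The bump \<open>b\<close> is positive exactly on the open unit interval; its primitive G
  is constant on either side, and reversing and normalising G gives the step.\<close>

lemma smooth_step:
  obtains u :: "real \<Rightarrow> real"
  where "smooth u" "\<And>x. 0 \<le> u x" "\<And>x. u x \<le> 1" "\<And>x. x \<le> 0 \<Longrightarrow> u x = 1"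
    "\<And>x. x \<ge> 1 \<Longrightarrow> u x = 0"
proof -
  define b where "b = (\<lambda>x::real. flat_fun 0 x * flat_fun 0 (1 - x))"
  have sb: "smooth b"
    unfolding b_def by (intro smooth_mult smooth_flat_fun smooth_compose[OF smooth_flat_fun] smooth_intros)
  then obtain G where G: "\<And>x. (G has_real_derivative b x) (at x)"
    using continuous_antiderivative smooth_imp_continuous_on by blast
  have b0: "b x \<ge> 0" for x by (simp add: b_def flat_fun_def)
  have mono: "G x \<le> G y" if "x \<le> y" for x y
    using DERIV_nonneg_imp_nondecreasing[OF that] G b0 by blast
  have pos: "b x > 0" if "0 < x" "x < 1" for x
    using that by (simp add: b_def flat_fun_def)
  have cont: "continuous_on {0..1} G"
    using G by (auto intro!: continuous_at_imp_continuous_on DERIV_isCont)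
  have less: "G 0 < G 1"
    by (rule DERIV_pos_imp_increasing_open[OF zero_less_one _ cont]) (use G pos in blast)
  have left: "G x = G 0" if "x \<le> 0" for x
  proof -
    have "b y = 0" if "y \<le> 0" for y using that by (simp add: b_def flat_fun_def)
    then have "G 0 \<le> G x"
      by (intro DERIV_nonpos_imp_nonincreasing[OF that]) (metis G order_refl)
    then show ?thesis using mono[OF that] by simp
  qed
  have right: "G x = G 1" if "x \<ge> 1" for x
  proof -
    have "b y = 0" if "y \<ge> 1" for y using that by (simp add: b_def flat_fun_def)
    then have "G x \<le> G 1"
      by (intro DERIV_nonpos_imp_nonincreasing[OF that]) (metis G order_refl)
    then show ?thesis using mono[OF that] by simp
  qed
  have bounds: "G 0 \<le> G x" "G x \<le> G 1" for x
    using mono[of 0 x] mono[of x 1] left[of x] right[of x] less by linarith+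
  show ?thesis
  proof (rule that[of "\<lambda>x. (G 1 - G x) * (1 / (G 1 - G 0))"])
    show "smooth (\<lambda>x. (G 1 - G x) * (1 / (G 1 - G 0)))"
      by (intro smooth_intros smooth_real[OF G sb])
    fix x
    show "0 \<le> (G 1 - G x) * (1 / (G 1 - G 0))" "(G 1 - G x) * (1 / (G 1 - G 0)) \<le> 1"
      using less bounds[of x] by (simp_all add: field_simps)
    show "(G 1 - G x) * (1 / (G 1 - G 0)) = 1" if "x \<le> 0"
      using less left[OF that] by simp
    show "(G 1 - G x) * (1 / (G 1 - G 0)) = 0" if "x \<ge> 1"
      using right[OF that] by simp
  qed
qed

section \<open>Exact isotopies and twists\<close>

text \<open>Multiplication by the imaginary unit in the coordinates \<open>x\<^sub>k + \<i> y\<^sub>k\<close>.\<close>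

definition cJ :: "'n::finite phase \<Rightarrow> 'n phase" where
  "cJ z = (- snd z, fst z)"

text \<open>Multiplication by exp(i alpha) in all complex coordinates at once, a unitary
  map.\<close>

definition rot :: "real \<Rightarrow> 'n::finite phase \<Rightarrow> 'n phase" where
  "rot \<alpha> z = cos \<alpha> *\<^sub>R z + sin \<alpha> *\<^sub>R cJ z"

lemma bounded_linear_cJ: "bounded_linear cJ"
  unfolding cJ_def
  by (intro bounded_linear_Pair bounded_linear_minus bounded_linear_fst bounded_linear_snd)

lemmas linear_cJ = bounded_linear.linear[OF bounded_linear_cJ]

lemmas cJ_simps = linear_add[OF linear_cJ] linear_diff[OF linear_cJ] linear_cmul[OF linear_cJ]
  linear_0[OF linear_cJ]

lemma cJ_cJ [simp]: "cJ (cJ z) = - z"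
  by (simp add: cJ_def prod_eq_iff)

lemma cJ_inner_left: "cJ u \<bullet> v = - (u \<bullet> cJ v)"
  by (simp add: cJ_def inner_prod_def)

lemma cJ_inner_cJ [simp]: "cJ u \<bullet> cJ v = u \<bullet> v"
  by (simp add: cJ_def inner_prod_def)

lemma cJ_inner_self [simp]: "cJ u \<bullet> u = 0" "u \<bullet> cJ u = 0"
  by (simp_all add: cJ_def inner_prod_def inner_commute)

lemma norm_cJ [simp]: "norm (cJ z) = norm z"
  by (simp add: norm_eq_sqrt_inner)

text \<open>Here and for \<open>liouville_form\<close> the coordinate sums disappear, so that every
  later symplectic computation is algebra with \<open>cJ\<close> and the inner product.\<close>

lemma symplectic_form_cJ: "symplectic_form u v = cJ u \<bullet> v"
  by (simp add: symplectic_form_def cJ_def inner_prod_def inner_vec_def sum_subtractf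
      sum_negf mult.commute)

lemma liouville_form_cJ: "liouville_form z v = (cJ z \<bullet> v) / 2"
  by (simp add: liouville_form_def cJ_def inner_prod_def inner_vec_def sum_subtractf sum_negf)

lemma linear_rot: "linear (rot \<alpha>)"
  unfolding rot_def by (intro linearI) (simp_all add: cJ_simps algebra_simps)

lemmas rot_simps = linear_add[OF linear_rot] linear_diff[OF linear_rot] linear_cmul[OF linear_rot]
  linear_0[OF linear_rot]

lemma cJ_rot: "cJ (rot \<alpha> z) = rot \<alpha> (cJ z)"
  by (simp add: rot_def cJ_simps)

lemma rot_0 [simp]: "rot 0 z = z"
  by (simp add: rot_def)

lemma rot_add: "rot \<alpha> (rot \<beta> z) = rot (\<alpha> + \<beta>) z"
  by (simp add: rot_def cJ_simps cos_add sin_add algebra_simps)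

lemma rot_inner_rot [simp]: "rot \<alpha> u \<bullet> rot \<alpha> v = u \<bullet> v"
proof -
  have "rot \<alpha> u \<bullet> rot \<alpha> v = cos \<alpha> * (cos \<alpha> * (u \<bullet> v)) + sin \<alpha> * (sin \<alpha> * (u \<bullet> v))"
    by (simp add: rot_def inner_simps cJ_inner_left algebra_simps)
  also have "\<dots> = (cos \<alpha> * cos \<alpha> + sin \<alpha> * sin \<alpha>) * (u \<bullet> v)"
    by (simp only: distrib_right mult.assoc)
  finally show ?thesis by (simp only: sin_cos_squared_add3 mult_1)
qed

lemma norm_rot [simp]: "norm (rot \<alpha> z) = norm z"
  by (simp add: norm_eq_sqrt_inner)

lemma dist_rot [simp]: "dist (rot \<alpha> z) (rot \<alpha> w) = dist z w"
  by (simp add: dist_norm flip: rot_simps(2))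

text \<open>The inner product with z kills the \<open>cJ\<close> part and leaves cos alpha = 1 for
  nonzero z. All period counts rest on this criterion.\<close>

lemma rot_eq_self_iff: "rot \<alpha> z = z \<longleftrightarrow> z = 0 \<or> (\<exists>k::int. \<alpha> = 2 * pi * of_int k)"
proof
  assume eq: "rot \<alpha> z = z"
  show "z = 0 \<or> (\<exists>k::int. \<alpha> = 2 * pi * of_int k)"
  proof (rule disjCI)
    assume "\<not> (\<exists>k::int. \<alpha> = 2 * pi * of_int k)"
    then have "cos \<alpha> \<noteq> 1"
      by (metis cos_one_2pi_int mult.assoc mult.commute)
    have "z \<bullet> rot \<alpha> z = cos \<alpha> * (z \<bullet> z)"
      by (simp add: rot_def inner_simps)
    with eq \<open>cos \<alpha> \<noteq> 1\<close> show "z = 0"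
      by simp
  qed
next
  assume "z = 0 \<or> (\<exists>k::int. \<alpha> = 2 * pi * of_int k)"
  then show "rot \<alpha> z = z"
    by (auto simp: rot_def cJ_simps)
qed

text \<open>
  Every map is defined on the whole of \<open>\<real>\<^sup>2\<^sup>m\<close>, for all times, so that smoothness never refers to
  boundary points.
\<close>

definition exact_isotopy ::
  "(real \<Rightarrow> 'n::finite phase \<Rightarrow> 'n phase) \<Rightarrow> (real \<Rightarrow> 'n phase \<Rightarrow> real) \<Rightarrow> bool" where
  "exact_isotopy \<phi> \<sigma> \<longleftrightarrow>
     smooth (\<lambda>p. \<phi> (fst p) (snd p))
     \<and> (\<exists>\<psi>. smooth (\<lambda>p. \<psi> (fst p) (snd p)) \<and> (\<forall>t z. \<phi> t (\<psi> t z) = z \<and> \<psi> t (\<phi> t z) = z))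
     \<and> (\<forall>z. \<phi> 0 z = z)
     \<and> (\<forall>t z. \<exists>D. (\<phi> t has_derivative D) (at z)
          \<and> (\<forall>u v. symplectic_form (D u) (D v) = symplectic_form u v)
          \<and> (\<sigma> t has_derivative (\<lambda>v. liouville_form (\<phi> t z) (D v) - liouville_form z v)) (at z))
     \<and> (\<exists>r<1. \<forall>t z. norm z \<ge> r \<longrightarrow> \<phi> t z = z \<and> \<sigma> t z = 0)"

lemma exact_isotopy_derivative:
  assumes "exact_isotopy \<phi> \<sigma>"
  obtains D where "(\<phi> t has_derivative D) (at z)"
    "\<And>u v. symplectic_form (D u) (D v) = symplectic_form u v"
    "(\<sigma> t has_derivative (\<lambda>v. liouville_form (\<phi> t z) (D v) - liouville_form z v)) (at z)"
proof -
  have "\<forall>t z. \<exists>D. (\<phi> t has_derivative D) (at z)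
      \<and> (\<forall>u v. symplectic_form (D u) (D v) = symplectic_form u v)
      \<and> (\<sigma> t has_derivative (\<lambda>v. liouville_form (\<phi> t z) (D v) - liouville_form z v)) (at z)"
    using assms unfolding exact_isotopy_def by (elim conjE)
  then show ?thesis using that by blast
qed

lemma exact_isotopy_inverse:
  assumes "exact_isotopy \<phi> \<sigma>"
  obtains \<psi> where "smooth (\<lambda>p. \<psi> (fst p) (snd p))"
    "\<And>t z. \<phi> t (\<psi> t z) = z" "\<And>t z. \<psi> t (\<phi> t z) = z"
proof -
  have "\<exists>\<psi>. smooth (\<lambda>p. \<psi> (fst p) (snd p)) \<and> (\<forall>t z. \<phi> t (\<psi> t z) = z \<and> \<psi> t (\<phi> t z) = z)"
    using assms unfolding exact_isotopy_def by (elim conjE)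
  then obtain \<psi> where "smooth (\<lambda>p. \<psi> (fst p) (snd p)) \<and> (\<forall>t z. \<phi> t (\<psi> t z) = z \<and> \<psi> t (\<phi> t z) = z)" ..
  then show ?thesis
    by (intro that[of \<psi>]) (elim conjE, assumption, blast, blast)
qed

lemma exact_isotopy_0:
  assumes "exact_isotopy \<phi> \<sigma>"
  shows "\<phi> 0 z = z"
proof -
  have "\<forall>z. \<phi> 0 z = z"
    using assms unfolding exact_isotopy_def by (elim conjE)
  then show ?thesis ..
qed

lemma exact_isotopy_id: "exact_isotopy (\<lambda>t z. z) (\<lambda>t z. 0)"
  unfolding exact_isotopy_def
proof (intro conjI allI)
  show "\<exists>\<psi>. smooth (\<lambda>p. \<psi> (fst p) (snd p)) \<and> (\<forall>t z. \<psi> t z = z \<and> \<psi> t z = z)"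
    by (rule exI[of _ "\<lambda>t z. z"]) (auto intro: smooth_intros)
  show "\<exists>D. ((\<lambda>z. z) has_derivative D) (at z)
          \<and> (\<forall>u v. symplectic_form (D u) (D v) = symplectic_form u v)
          \<and> ((\<lambda>z. 0) has_derivative (\<lambda>v. liouville_form z (D v) - liouville_form z v)) (at z)" for z
    by (rule exI[of _ "\<lambda>v. v"]) auto
  show "\<exists>r<1. \<forall>t z. norm z \<ge> r \<longrightarrow> z = z \<and> (0::real) = 0"
    by (rule exI[of _ 0]) auto
qed (auto intro: smooth_intros)

text \<open>The pullback of lambda under the composite, minus lambda, splits as the pullback by
  \<open>\<psi> t\<close> of (\<open>\<phi> t\<close>-pullback of lambda minus lambda) plus
  (\<open>\<psi> t\<close>-pullback of lambda minus lambda). Primitives add accordingly, which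
  explains the inner map in the second summand.\<close>

lemma exact_isotopy_compose:
  assumes "exact_isotopy \<phi> \<sigma>" "exact_isotopy \<psi> \<tau>"
  shows "exact_isotopy (\<lambda>t z. \<phi> t (\<psi> t z)) (\<lambda>t z. \<tau> t z + \<sigma> t (\<psi> t z))"
proof -
  obtain \<phi>' where \<phi>': "smooth (\<lambda>p. \<phi>' (fst p) (snd p))" "\<And>t z. \<phi> t (\<phi>' t z) = z" "\<And>t z. \<phi>' t (\<phi> t z) = z"
    by (rule exact_isotopy_inverse[OF assms(1)]) (rule that)
  obtain \<psi>' where \<psi>': "smooth (\<lambda>p. \<psi>' (fst p) (snd p))" "\<And>t z. \<psi> t (\<psi>' t z) = z" "\<And>t z. \<psi>' t (\<psi> t z) = z"
    by (rule exact_isotopy_inverse[OF assms(2)]) (rule that)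
  have sm: "smooth (\<lambda>p. \<phi> (fst p) (snd p))" "smooth (\<lambda>p. \<psi> (fst p) (snd p))"
    using assms unfolding exact_isotopy_def by blast+
  obtain r where r: "r < 1" "\<And>t z. norm z \<ge> r \<Longrightarrow> \<phi> t z = z \<and> \<sigma> t z = 0"
    using assms(1) unfolding exact_isotopy_def by blast
  obtain r' where r': "r' < 1" "\<And>t z. norm z \<ge> r' \<Longrightarrow> \<psi> t z = z \<and> \<tau> t z = 0"
    using assms(2) unfolding exact_isotopy_def by blast
  show ?thesis
    unfolding exact_isotopy_def
  proof (intro conjI allI)
    have "smooth (\<lambda>p. (fst p, \<psi> (fst p) (snd p)))" "smooth (\<lambda>p. (fst p, \<phi>' (fst p) (snd p)))"
      by (intro smooth_intros sm \<phi>')+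
    from smooth_compose[OF sm(1) this(1)] smooth_compose[OF \<psi>'(1) this(2)]
    show "smooth (\<lambda>p. \<phi> (fst p) (\<psi> (fst p) (snd p)))"
      and "\<exists>\<chi>'. smooth (\<lambda>p. \<chi>' (fst p) (snd p)) \<and> (\<forall>t z. \<phi> t (\<psi> t (\<chi>' t z)) = z \<and> \<chi>' t (\<phi> t (\<psi> t z)) = z)"
      by (simp, intro exI[of _ "\<lambda>t z. \<psi>' t (\<phi>' t z)"], simp add: \<phi>' \<psi>')
    show "\<phi> 0 (\<psi> 0 z) = z" for z
      by (simp only: exact_isotopy_0[OF assms(1)] exact_isotopy_0[OF assms(2)])
    show "\<exists>D. ((\<lambda>z. \<phi> t (\<psi> t z)) has_derivative D) (at z)
          \<and> (\<forall>u v. symplectic_form (D u) (D v) = symplectic_form u v)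
          \<and> ((\<lambda>z. \<tau> t z + \<sigma> t (\<psi> t z)) has_derivative
               (\<lambda>v. liouville_form (\<phi> t (\<psi> t z)) (D v) - liouville_form z v)) (at z)" for t z
    proof -
      obtain E where E: "(\<psi> t has_derivative E) (at z)"
        "\<And>u v. symplectic_form (E u) (E v) = symplectic_form u v"
        "(\<tau> t has_derivative (\<lambda>v. liouville_form (\<psi> t z) (E v) - liouville_form z v)) (at z)"
        using exact_isotopy_derivative[OF assms(2)] by blast
      obtain D where D: "(\<phi> t has_derivative D) (at (\<psi> t z))"
        "\<And>u v. symplectic_form (D u) (D v) = symplectic_form u v"
        "(\<sigma> t has_derivative (\<lambda>v. liouville_form (\<phi> t (\<psi> t z)) (D v) - liouville_form (\<psi> t z) v)) (at (\<psi> t z))"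
        using exact_isotopy_derivative[OF assms(1)] by blast
      have "((\<lambda>z. \<phi> t (\<psi> t z)) has_derivative (\<lambda>v. D (E v))) (at z)"
        using diff_chain_at[OF E(1) D(1)] by (simp add: o_def)
      moreover have "((\<lambda>z. \<tau> t z + \<sigma> t (\<psi> t z)) has_derivative
               (\<lambda>v. liouville_form (\<phi> t (\<psi> t z)) (D (E v)) - liouville_form z v)) (at z)"
        using has_derivative_add[OF E(3) diff_chain_at[OF E(1) D(3), unfolded o_def]] by simp
      ultimately show ?thesis
        using D(2) E(2) by (intro exI[of _ "\<lambda>v. D (E v)"]) auto
    qed
    show "\<exists>r<1. \<forall>t z. norm z \<ge> r \<longrightarrow> \<phi> t (\<psi> t z) = z \<and> \<tau> t z + \<sigma> t (\<psi> t z) = 0"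
      by (rule exI[of _ "max r r'"]) (use r r' in auto)
  qed
qed

lemma exact_isotopy_Diff_c:
  assumes "exact_isotopy \<phi> \<sigma>"
  shows "\<phi> t \<in> Diff_c"
proof -
  let ?B = "unit_ball :: 'a phase set"
  obtain \<psi> where \<psi>: "smooth (\<lambda>p. \<psi> (fst p) (snd p))" "\<And>t z. \<phi> t (\<psi> t z) = z" "\<And>t z. \<psi> t (\<phi> t z) = z"
    by (rule exact_isotopy_inverse[OF assms]) (rule that)
  obtain r where r: "r < 1" "\<And>z. norm z \<ge> r \<Longrightarrow> \<phi> t z = z"
    using assms unfolding exact_isotopy_def by blast
  have sm: "smooth (\<lambda>p. \<phi> (fst p) (snd p))"
    using assms unfolding exact_isotopy_def by blast
  have smt: "smooth (f t)" if "smooth (\<lambda>p. f (fst p) (snd p))" for f :: "real \<Rightarrow> 'a phase \<Rightarrow> 'a phase"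
    using smooth_compose[OF that smooth_Pair[OF smooth_const[of t] smooth_ident]] by simp
  \<comment> \<open>A point of the ball sent outside would land on a fixed point of
    \<open>\<phi> t\<close>, and injectivity would make it that fixed point itself.\<close>
  have in1: "\<phi> t z \<in> ?B" if "z \<in> ?B" for z
  proof (rule ccontr)
    assume "\<phi> t z \<notin> ?B"
    then have "\<phi> t (\<phi> t z) = \<phi> t z" using r by simp
    then have "\<phi> t z = z" using \<psi>(3) by metis
    with that \<open>\<phi> t z \<notin> ?B\<close> show False by simp
  qed
  have in2: "\<psi> t z \<in> ?B" if "z \<in> ?B" for z
  proof (rule ccontr)
    assume "\<psi> t z \<notin> ?B"
    then have "\<phi> t (\<psi> t z) = \<psi> t z" using r by simp
    with that \<open>\<psi> t z \<notin> ?B\<close> \<psi>(2) show False by simp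
  qed
  have bij: "bij_betw (\<phi> t) ?B ?B"
    by (rule bij_betwI[of _ _ _ "\<psi> t"]) (use in1 in2 \<psi> in auto)
  have inv: "inv_into ?B (\<phi> t) z = \<psi> t z" if "z \<in> ?B" for z
    using that by (intro inv_into_f_eq bij_betw_imp_inj_on[OF bij] in2 \<psi>)
  have "smooth_on ?B (inv_into ?B (\<phi> t))"
    unfolding smooth_on_def
    using smt[OF \<psi>(1)] inv unfolding smooth_def by (metis Int_iff UNIV_I open_UNIV)
  moreover have "symplectic_on_ball (\<phi> t)"
    unfolding symplectic_on_ball_def
  proof (intro ballI allI)
    fix z u v
    obtain D where "(\<phi> t has_derivative D) (at z)"
        "\<And>u v. symplectic_form (D u) (D v) = symplectic_form u v"
      using exact_isotopy_derivative[OF assms] by blast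
    then show "symplectic_form (frechet_derivative (\<phi> t) (at z) u) (frechet_derivative (\<phi> t) (at z) v)
        = symplectic_form u v"
      using frechet_derivative_at by metis
  qed
  moreover have "\<exists>K. compact K \<and> K \<subseteq> ?B \<and> (\<forall>z\<in>?B - K. \<phi> t z = z)"
    by (rule exI[of _ "cball 0 r"]) (use r in auto)
  ultimately show ?thesis
    unfolding Diff_c_def using bij smooth_imp_smooth_on[OF smt[OF sm]] by blast
qed

lemma exact_isotopy_compactly_supported:
  assumes "exact_isotopy \<phi> \<sigma>"
  shows "compactly_supported_isotopy \<phi>"
proof -
  obtain r where "r < 1" "\<And>t z. norm z \<ge> r \<Longrightarrow> \<phi> t z = z"
    using assms unfolding exact_isotopy_def by blast
  then have "\<exists>K. compact K \<and> K \<subseteq> ball 0 1 \<and> (\<forall>t\<in>{0..1}. \<forall>z\<in>ball 0 1 - K. \<phi> t z = z)"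
    by (intro exI[of _ "cball 0 r"]) auto
  moreover have "smooth (\<lambda>(t, z). \<phi> t z)"
    using assms unfolding exact_isotopy_def by (simp add: case_prod_unfold)
  ultimately show ?thesis
    unfolding compactly_supported_isotopy_def
    using exact_isotopy_Diff_c[OF assms] smooth_imp_smooth_on by blast
qed

text \<open>The function carried along with the isotopy meets the defining conditions, and
  uniqueness of the action identifies it with the \<open>THE\<close> term.\<close>

lemma exact_isotopy_action:
  assumes "exact_isotopy \<phi> \<sigma>"
  shows "action (\<phi> t) = \<sigma> t"
proof -
  obtain r where r: "r < 1" "\<And>z. norm z \<ge> r \<Longrightarrow> \<sigma> t z = 0"
    using assms unfolding exact_isotopy_def by blast
  have "is_action (\<phi> t) (\<sigma> t)"
    unfolding is_action_def
  proof (intro conjI ballI)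
    fix z :: "'a phase"
    obtain D where "(\<phi> t has_derivative D) (at z)"
        "(\<sigma> t has_derivative (\<lambda>v. liouville_form (\<phi> t z) (D v) - liouville_form z v)) (at z)"
      using exact_isotopy_derivative[OF assms] by blast
    then show "(\<sigma> t has_derivative
        (\<lambda>v. pullback_1form (\<phi> t) liouville_form z v - liouville_form z v)) (at z)"
      by (simp add: pullback_1form_def flip: frechet_derivative_at)
  next
    show "\<exists>U. open U \<and> frontier unit_ball \<subseteq> U \<and> (\<forall>z\<in>U \<inter> unit_ball. \<sigma> t z = 0)"
      by (rule exI[of _ "- cball 0 r"]) (use r in \<open>auto simp: frontier_ball open_Compl\<close>)
    show "\<forall>z. z \<notin> unit_ball \<longrightarrow> \<sigma> t z = 0"
      using r by auto
  qed
  then show ?thesis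
    unfolding action_def using is_action_unique by blast
qed

lemma exact_isotopy_action_continuous:
  assumes "exact_isotopy \<phi> \<sigma>"
  shows "continuous_on S (\<sigma> t)"
proof -
  have "isCont (\<sigma> t) z" for z
    by (rule exact_isotopy_derivative[OF assms]) (rule has_derivative_continuous)
  then show ?thesis
    by (simp add: continuous_at_imp_continuous_on)
qed

section \<open>Twists: rotations about a centre by an angle depending on the distance\<close>

text \<open>Varying the angle moves the point along \<open>cJ (z - c)\<close>, turned by the current
  angle. Pulling \<open>rot\<close> out of the whole derivative matters later: it preserves inner
  products and commutes with \<open>cJ\<close>, so it drops out of all identities.\<close>

lemma twist_has_derivative:
  fixes c z :: "'n::finite phase"
  assumes "(\<theta> has_real_derivative \<theta>') (at ((z - c) \<bullet> (z - c)))"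
  shows "((\<lambda>z. c + rot (\<theta> ((z - c) \<bullet> (z - c))) (z - c)) has_derivative
     (\<lambda>v. rot (\<theta> ((z - c) \<bullet> (z - c))) (v + (2 * \<theta>' * ((z - c) \<bullet> v)) *\<^sub>R cJ (z - c)))) (at z)"
proof -
  have s: "((\<lambda>z. (z - c) \<bullet> (z - c)) has_derivative (\<lambda>v. 2 * ((z - c) \<bullet> v))) (at z)"
    by (auto intro!: derivative_eq_intros simp: inner_commute)
  have "((\<lambda>z. \<theta> ((z - c) \<bullet> (z - c))) has_derivative (\<lambda>v. \<theta>' * (2 * ((z - c) \<bullet> v)))) (at z)"
    using diff_chain_at[OF s assms[unfolded has_field_derivative_def]] by (simp add: o_def)
  then obtain g where g: "g = (\<lambda>z. \<theta> ((z - c) \<bullet> (z - c)))"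
    and g': "(g has_derivative (\<lambda>v. \<theta>' * (2 * ((z - c) \<bullet> v)))) (at z)"
    by blast
  have w: "((\<lambda>z. z - c) has_derivative (\<lambda>v. v)) (at z)"
    by (auto intro!: derivative_eq_intros)
  have A: "((\<lambda>z. c + rot (g z) (z - c)) has_derivative
     (\<lambda>v. 0 + ((cos (g z) *\<^sub>R v + ((\<theta>' * (2 * ((z - c) \<bullet> v))) * - sin (g z)) *\<^sub>R (z - c)) +
       (sin (g z) *\<^sub>R cJ v + ((\<theta>' * (2 * ((z - c) \<bullet> v))) * cos (g z)) *\<^sub>R cJ (z - c))))) (at z)"
    unfolding rot_def
    by (intro has_derivative_add has_derivative_const has_derivative_scaleR w
        bounded_linear.has_derivative[OF bounded_linear_cJ w] has_derivative_cos[OF g']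
        has_derivative_sin[OF g'])
  have B: "0 + ((cos (g z) *\<^sub>R v + ((\<theta>' * (2 * (w \<bullet> v))) * - sin (g z)) *\<^sub>R w) +
       (sin (g z) *\<^sub>R cJ v + ((\<theta>' * (2 * (w \<bullet> v))) * cos (g z)) *\<^sub>R cJ w)) =
     rot (g z) (v + (2 * \<theta>' * (w \<bullet> v)) *\<^sub>R cJ w)" for v w
    by (simp add: rot_def cJ_simps algebra_simps)
  show ?thesis
    using has_derivative_eq_rhs[OF A ext[OF B]] unfolding g .
qed

text \<open>With w = z - c and s = |w|^2, the part of the pullback of lambda relative to c changes
  by s theta'(s) <w, v>, which is the differential of H(s) when H' = s theta'/2. Moving the base
  point from c to the origin adds to lambda the constant form <\<open>cJ c\<close>, v>/2, which
  yields the second summand. The inverse is the twist by the opposite angle, as |w| is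
  preserved.\<close>

lemma twist_exact_isotopy:
  fixes c :: "'n::finite phase"
  defines "\<phi> \<equiv> \<lambda>\<theta> t z. c + rot (t * \<theta> ((z - c) \<bullet> (z - c))) (z - c)"
  assumes \<theta>: "smooth \<theta>" "\<And>s. (\<theta> has_real_derivative \<theta>' s) (at s)"
    and H: "\<And>s. (H has_real_derivative s / 2 * \<theta>' s) (at s)"
    and supp: "\<And>s. s \<ge> a\<^sup>2 \<Longrightarrow> \<theta> s = 0" "\<And>s. s \<ge> a\<^sup>2 \<Longrightarrow> H s = 0"
    and r: "ball c a \<subseteq> ball 0 r" "r < 1" "a > 0"
  shows "exact_isotopy (\<phi> \<theta>) (\<lambda>t z. t * H ((z - c) \<bullet> (z - c)) + cJ c \<bullet> (\<phi> \<theta> t z - z) / 2)"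
  unfolding exact_isotopy_def
proof (intro conjI allI)
  have sm: "smooth (\<lambda>p. \<phi> \<theta> (fst p) (snd p))" if "smooth \<theta>" for \<theta>
    unfolding \<phi>_def rot_def
    by (intro smooth_intros smooth_compose[OF that] smooth_bounded_linear[OF bounded_linear_cJ])
  show "smooth (\<lambda>p. \<phi> \<theta> (fst p) (snd p))"
    by (rule sm[OF \<theta>(1)])
  have "smooth (\<lambda>s. - \<theta> s)"
    by (rule smooth_bounded_linear[OF bounded_linear_minus[OF bounded_linear_ident] \<theta>(1)])
  from sm[OF this] show "\<exists>\<psi>. smooth (\<lambda>p. \<psi> (fst p) (snd p)) \<and>
      (\<forall>t z. \<phi> \<theta> t (\<psi> t z) = z \<and> \<psi> t (\<phi> \<theta> t z) = z)"
    by (intro exI[of _ "\<phi> (\<lambda>s. - \<theta> s)"]) (simp add: \<phi>_def rot_add)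
  show "\<phi> \<theta> 0 z = z" for z
    by (simp add: \<phi>_def)
  show "\<exists>r<1. \<forall>t z. norm z \<ge> r \<longrightarrow> \<phi> \<theta> t z = z \<and> t * H ((z - c) \<bullet> (z - c)) + cJ c \<bullet> (\<phi> \<theta> t z - z) / 2 = 0"
  proof (intro exI[of _ r] conjI allI impI r)
    fix t and z :: "'n phase" assume "norm z \<ge> r"
    then have "z \<notin> ball c a" using r by auto
    then have "(z - c) \<bullet> (z - c) \<ge> a\<^sup>2"
      using r by (simp add: dist_norm norm_minus_commute flip: power2_norm_eq_inner)
    note zero = supp[OF this]
    show *: "\<phi> \<theta> t z = z"
      by (simp add: \<phi>_def zero)
    show "t * H ((z - c) \<bullet> (z - c)) + cJ c \<bullet> (\<phi> \<theta> t z - z) / 2 = 0"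
      unfolding * by (simp add: zero)
  qed
  fix t and z :: "'n phase"
  define w where "w = z - c"
  define \<alpha> where "\<alpha> = t * \<theta> (w \<bullet> w)"
  define \<kappa> where "\<kappa> = t * \<theta>' (w \<bullet> w)"
  define D where "D = (\<lambda>v. rot \<alpha> (v + (2 * \<kappa> * (w \<bullet> v)) *\<^sub>R cJ w))"
  have "((\<lambda>s. t * \<theta> s) has_real_derivative \<kappa>) (at ((z - c) \<bullet> (z - c)))"
    unfolding \<kappa>_def w_def by (intro DERIV_cmult \<theta>)
  from twist_has_derivative[OF this] have D: "(\<phi> \<theta> t has_derivative D) (at z)"
    by (simp add: \<phi>_def D_def \<alpha>_def w_def)
  have s: "((\<lambda>z. (z - c) \<bullet> (z - c)) has_derivative (\<lambda>v. 2 * (w \<bullet> v))) (at z)"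
    unfolding w_def by (auto intro!: derivative_eq_intros simp: inner_commute)
  have "((\<lambda>z. H ((z - c) \<bullet> (z - c))) has_derivative (\<lambda>v. (w \<bullet> w) / 2 * \<theta>' (w \<bullet> w) * (2 * (w \<bullet> v)))) (at z)"
    using diff_chain_at[OF s H[unfolded has_field_derivative_def]] by (simp add: o_def w_def)
  then have "((\<lambda>z. t * H ((z - c) \<bullet> (z - c)) + cJ c \<bullet> (\<phi> \<theta> t z - z) / 2) has_derivative
      (\<lambda>v. t * ((w \<bullet> w) / 2 * \<theta>' (w \<bullet> w) * (2 * (w \<bullet> v))) + cJ c \<bullet> (D v - v) / 2)) (at z)"
    by (auto intro!: derivative_eq_intros D)
  moreover have "t * ((w \<bullet> w) / 2 * \<theta>' (w \<bullet> w) * (2 * (w \<bullet> v))) + cJ c \<bullet> (D v - v) / 2 =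
      liouville_form (\<phi> \<theta> t z) (D v) - liouville_form z v" for v
  proof -
    have \<phi>z: "\<phi> \<theta> t z = c + rot \<alpha> w" and z: "z = c + w"
      by (simp_all add: \<phi>_def \<alpha>_def w_def)
    have "cJ (rot \<alpha> w) \<bullet> D v = cJ w \<bullet> v + 2 * \<kappa> * (w \<bullet> v) * (w \<bullet> w)"
      by (simp add: D_def cJ_rot inner_simps)
    moreover have "cJ z \<bullet> v = cJ c \<bullet> v + cJ w \<bullet> v"
      unfolding z by (simp add: cJ_simps inner_simps)
    ultimately show ?thesis
      unfolding liouville_form_cJ \<phi>z by (simp add: cJ_simps inner_simps \<kappa>_def field_simps)
  qed
  \<comment> \<open>The two mixed terms are opposite multiples of <w, u> <w, v>, and the quadratic
    term contains <w, \<open>cJ w\<close>> = 0.\<close>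
  moreover have "symplectic_form (D u) (D v) = symplectic_form u v" for u v
    by (simp add: symplectic_form_cJ D_def cJ_rot cJ_simps inner_simps cJ_inner_left[of w] inner_commute)
  ultimately show "\<exists>D. (\<phi> \<theta> t has_derivative D) (at z)
      \<and> (\<forall>u v. symplectic_form (D u) (D v) = symplectic_form u v)
      \<and> ((\<lambda>z. t * H ((z - c) \<bullet> (z - c)) + cJ c \<bullet> (\<phi> \<theta> t z - z) / 2) has_derivative
        (\<lambda>v. liouville_form (\<phi> \<theta> t z) (D v) - liouville_form z v)) (at z)"
    using D by (intro exI[of _ D]) auto
qed

text \<open>The cutoff u drops from 1 to 0 between b' and b, and h is its action profile. Since 0 <=
  u <= 1, the primitive K of u vanishing at b lies between s - b and 0 for s <= b, which puts h
  between 0 and b/2; on the inner part K has slope 1 and K(b') <= 0, which gives the lower bound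
  b'/2.\<close>

lemma twist_profile:
  fixes b b' :: real
  assumes "0 < b'" "b' < b"
  obtains u u' h :: "real \<Rightarrow> real"
  where "smooth u" "\<And>s. (u has_real_derivative u' s) (at s)"
    "\<And>s. (h has_real_derivative s / 2 * u' s) (at s)"
    "\<And>s. 0 \<le> u s" "\<And>s. u s \<le> 1" "\<And>s. s \<le> b' \<Longrightarrow> u s = 1" "\<And>s. s \<ge> b \<Longrightarrow> u s = 0"
    "\<And>s. s \<ge> b \<Longrightarrow> h s = 0" "\<And>s. s \<ge> 0 \<Longrightarrow> 0 \<le> h s" "\<And>s. s \<ge> 0 \<Longrightarrow> h s \<le> b / 2"
    "\<And>s. 0 \<le> s \<Longrightarrow> s \<le> b' \<Longrightarrow> h s \<ge> b' / 2"
proof -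
  obtain \<eta> :: "real \<Rightarrow> real" where \<eta>: "smooth \<eta>" "\<And>x. 0 \<le> \<eta> x" "\<And>x. \<eta> x \<le> 1"
    "\<And>x. x \<le> 0 \<Longrightarrow> \<eta> x = 1" "\<And>x. x \<ge> 1 \<Longrightarrow> \<eta> x = 0"
    using smooth_step by blast
  define u where "u = (\<lambda>s. \<eta> ((s - b') * (1 / (b - b'))))"
  have su: "smooth u"
    unfolding u_def by (intro smooth_compose[OF \<eta>(1)] smooth_intros)
  have u: "0 \<le> u s" "u s \<le> 1" "s \<le> b' \<Longrightarrow> u s = 1" "s \<ge> b \<Longrightarrow> u s = 0" for s
    unfolding u_def using \<eta> assms by (auto simp: field_simps)
  have "\<exists>d. (u has_real_derivative d) (at s)" for s
    using smooth_has_derivative[OF su, of s] by (meson has_field_derivative_def differentiable_def real_differentiable_def)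
  then obtain u' where u': "\<And>s. (u has_real_derivative u' s) (at s)" by metis
  obtain K0 where K0: "\<And>s. (K0 has_real_derivative u s) (at s)"
    using continuous_antiderivative smooth_imp_continuous_on[OF su] by blast
  define K where "K = (\<lambda>s. K0 s - K0 b)"
  have K: "(K has_real_derivative u s) (at s)" for s
    unfolding K_def using K0 by (auto intro!: derivative_eq_intros)
  have Ks: "((\<lambda>s. K s - s) has_real_derivative u s - 1) (at s)" for s
    by (auto intro!: derivative_eq_intros K)
  have Kb: "K b = 0" by (simp add: K_def)
  have K_ge: "K s = 0" if "s \<ge> b" for s
  proof -
    have "K b \<le> K s"
      using DERIV_nonneg_imp_nondecreasing[OF that] K u by metis
    moreover have "K s \<le> K b"
      using DERIV_nonpos_imp_nonincreasing[OF that] K u by (metis order_refl)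
    ultimately show ?thesis using Kb by simp
  qed
  have K_le: "K s \<le> 0" if "s \<le> b" for s
    using DERIV_nonneg_imp_nondecreasing[OF that, of K] K u Kb by metis
  have K_lower: "s - b \<le> K s" if "s \<le> b" for s
  proof -
    have "K b - b \<le> K s - s"
      by (rule DERIV_nonpos_imp_nonincreasing[OF that]) (use Ks u in \<open>meson diff_le_0_iff_le\<close>)
    then show ?thesis using Kb by simp
  qed
  have K_upper: "K s \<le> s - b'" if "s \<le> b'" for s
  proof -
    have "K s - s \<le> K b' - b'"
      by (rule DERIV_nonneg_imp_nondecreasing[OF that]) (use Ks u in \<open>metis diff_self order_refl\<close>)
    then show ?thesis using K_le[of b'] assms by simp
  qed
  \<comment> \<open>Integration by parts of s u'(s)/2: the bounds follow from those of u and K, with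
    no information on u'.\<close>
  define h where "h = (\<lambda>s. (s * u s - K s) / 2)"
  show ?thesis
  proof (rule that[OF su u' _ u])
    show "(h has_real_derivative s / 2 * u' s) (at s)" for s
      unfolding h_def by (auto intro!: derivative_eq_intros u' K)
    show "h s = 0" if "s \<ge> b" for s
      using that by (simp add: h_def u K_ge)
    show "0 \<le> h s" if "s \<ge> 0" for s
      using K_le[of s] K_ge[of s] mult_nonneg_nonneg[OF that u(1)[of s]]
      by (cases "s \<le> b") (simp_all add: h_def u)
    show "h s \<le> b / 2" if "s \<ge> 0" for s
    proof (cases "s \<le> b")
      case True
      have "s * u s \<le> s" using that u by (simp add: mult_left_le)
      then show ?thesis using K_lower[OF True] by (simp add: h_def)
    next
      case False
      then show ?thesis using assms by (simp add: h_def u K_ge)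
    qed
    show "h s \<ge> b' / 2" if "0 \<le> s" "s \<le> b'" for s
      using K_upper[OF that(2)] that by (simp add: h_def u)
  qed
qed

text \<open>The profile is restated in radii instead of squared radii. It is fixed before the
  amplitude A, so the same cutoff serves the large negative angles in the small balls and the small
  positive angle of the global rotation.\<close>

lemma twist_isotopy:
  fixes c :: "'n::finite phase"
  assumes "0 < k" "k < 1" "0 < a" "ball c a \<subseteq> ball 0 r" "r < 1"
  obtains u h :: "real \<Rightarrow> real"
  where "\<And>A. exact_isotopy (\<lambda>t z. c + rot (t * A * u (norm (z - c))) (z - c))
      (\<lambda>t z. t * A * h (norm (z - c)) + cJ c \<bullet> (c + rot (t * A * u (norm (z - c))) (z - c) - z) / 2)"
    "\<And>s. 0 \<le> u s" "\<And>s. u s \<le> 1" "\<And>s. 0 \<le> s \<Longrightarrow> s \<le> k * a \<Longrightarrow> u s = 1" "\<And>s. s \<ge> a \<Longrightarrow> u s = 0"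
    "\<And>s. s \<ge> a \<Longrightarrow> h s = 0" "\<And>s. 0 \<le> h s" "\<And>s. h s \<le> a\<^sup>2 / 2"
    "\<And>s. 0 \<le> s \<Longrightarrow> s \<le> k * a \<Longrightarrow> h s \<ge> (k * a)\<^sup>2 / 2"
proof -
  have pos: "0 < (k * a)\<^sup>2" "(k * a)\<^sup>2 < a\<^sup>2"
    using assms by (auto intro!: power_strict_mono)
  obtain u u' h where su: "smooth u" and u': "\<And>s. (u has_real_derivative u' s) (at s)"
    and h': "\<And>s. (h has_real_derivative s / 2 * u' s) (at s)"
    and u: "\<And>s. 0 \<le> u s" "\<And>s. u s \<le> 1" "\<And>s. s \<le> (k * a)\<^sup>2 \<Longrightarrow> u s = 1" "\<And>s. s \<ge> a\<^sup>2 \<Longrightarrow> u s = 0"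
    and h: "\<And>s. s \<ge> a\<^sup>2 \<Longrightarrow> h s = 0" "\<And>s. s \<ge> 0 \<Longrightarrow> 0 \<le> h s" "\<And>s. s \<ge> 0 \<Longrightarrow> h s \<le> a\<^sup>2 / 2"
      "\<And>s. 0 \<le> s \<Longrightarrow> s \<le> (k * a)\<^sup>2 \<Longrightarrow> h s \<ge> (k * a)\<^sup>2 / 2"
    by (rule twist_profile[OF pos]) (rule that)
  show ?thesis
  proof (rule that[of "\<lambda>x. u (x\<^sup>2)" "\<lambda>x. h (x\<^sup>2)"])
    have sq: "a\<^sup>2 \<le> s\<^sup>2" if "a \<le> s" for s
      using that assms by (intro power_mono) auto
    have sq': "s\<^sup>2 \<le> (k * a)\<^sup>2" if "0 \<le> s" "s \<le> k * a" for s
      using that by (intro power_mono) auto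
    fix s
    show "0 \<le> u (s\<^sup>2)" "u (s\<^sup>2) \<le> 1" "0 \<le> h (s\<^sup>2)" "h (s\<^sup>2) \<le> a\<^sup>2 / 2"
      using u h by auto
    show "u (s\<^sup>2) = 0" "h (s\<^sup>2) = 0" if "s \<ge> a"
      using sq[OF that] u h by auto
    show "u (s\<^sup>2) = 1" "h (s\<^sup>2) \<ge> (k * a)\<^sup>2 / 2" if "0 \<le> s" "s \<le> k * a"
      using sq'[OF that] u h by auto
  next
    fix A
    show "exact_isotopy (\<lambda>t z. c + rot (t * A * u ((norm (z - c))\<^sup>2)) (z - c))
      (\<lambda>t z. t * A * h ((norm (z - c))\<^sup>2) + cJ c \<bullet> (c + rot (t * A * u ((norm (z - c))\<^sup>2)) (z - c) - z) / 2)"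
      unfolding power2_norm_eq_inner mult.assoc
    proof (rule twist_exact_isotopy[of "\<lambda>s. A * u s" "\<lambda>s. A * u' s" "\<lambda>s. A * h s"])
      show "((\<lambda>s. A * h s) has_real_derivative s / 2 * (A * u' s)) (at s)" for s
        using DERIV_cmult[OF h', of A s] by (simp add: algebra_simps)
      show "smooth (\<lambda>s. A * u s)" by (intro smooth_intros su)
      show "((\<lambda>s. A * u s) has_real_derivative A * u' s) (at s)" for s by (intro DERIV_cmult u')
      show "A * u s = 0" "A * h s = 0" if "s \<ge> a\<^sup>2" for s using u(4) h(1) that by simp_all
    qed (fact assms)+
  qed
qed

section \<open>The volume form on the coordinate frame\<close>

text \<open>A permutation respecting the conjugate pairs (x_i, y_i): \<open>\<pi>\<close> permutes
  the pairs, and S collects those whose two members are exchanged.\<close>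

definition pair_perm :: "('n \<Rightarrow> 'n) \<Rightarrow> 'n set \<Rightarrow> 'n \<times> bool \<Rightarrow> 'n \<times> bool" where
  "pair_perm \<pi> S = (\<lambda>(i, b). (\<pi> i, b \<noteq> (i \<in> S)))"

lemma pair_perm_permutes:
  assumes "\<pi> permutes (UNIV :: 'n::finite set)"
  shows "pair_perm \<pi> S permutes UNIV"
proof (rule inj_imp_permutes)
  show "inj_on (pair_perm \<pi> S) UNIV"
    using permutes_inj[OF assms] by (auto simp: inj_on_def pair_perm_def)
qed auto

lemma permutation_UNIV: "p permutes (UNIV :: 'a::finite set) \<Longrightarrow> permutation p"
  by (meson finite permutes_imp_permutation)

text \<open>A transposition of indices acts on the x and on the y coordinates, hence as two
  transpositions whose signs cancel.\<close>

lemma sign_pair_perm_empty: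
  assumes "\<pi> permutes (UNIV :: 'n::finite set)"
  shows "sign (pair_perm \<pi> {}) = 1"
  using assms finite
proof (induction rule: permutes_induct)
  case id
  have "pair_perm id ({} :: 'n set) = id" by (auto simp: pair_perm_def)
  then show ?case by (simp only: sign_id)
next
  case (swap a b p)
  let ?t = "\<lambda>c. Transposition.transpose (a, c) (b, c)"
  have eq: "pair_perm (Transposition.transpose a b \<circ> p) {} = ?t False \<circ> (?t True \<circ> pair_perm p {})"
    by (auto simp: pair_perm_def Transposition.transpose_def fun_eq_iff)
  have "permutation (pair_perm p {})"
    using pair_perm_permutes[OF swap.hyps(4)] permutation_UNIV by blast
  then show ?case
    unfolding eq using swap(3,5)
    by (simp only: sign_compose permutation_compose permutation_swap_id sign_swap_id) simp
qed

text \<open>Each flipped pair contributes exactly one transposition.\<close>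

lemma sign_pair_perm_id: "sign (pair_perm id (S :: 'n::finite set)) = (-1) ^ card S"
  using finite[of S]
proof (induction S rule: finite_induct)
  case empty
  have "pair_perm id ({} :: 'n set) = id" by (auto simp: pair_perm_def)
  then show ?case by (simp only: sign_id card.empty power_0)
next
  case (insert x S)
  have eq: "pair_perm id (insert x S) = Transposition.transpose (x, False) (x, True) \<circ> pair_perm id S"
    using insert by (auto simp: pair_perm_def Transposition.transpose_def fun_eq_iff)
  have "permutation (pair_perm id S)"
    using pair_perm_permutes[OF permutes_id] permutation_UNIV by blast
  then show ?case
    unfolding eq using insert
    by (simp only: sign_compose permutation_swap_id sign_swap_id) simp
qed

lemma sign_pair_perm:
  assumes "\<pi> permutes (UNIV :: 'n::finite set)"
  shows "sign (pair_perm \<pi> S) = (-1) ^ card S"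
proof -
  have "pair_perm \<pi> S = pair_perm \<pi> {} \<circ> pair_perm id S"
    by (auto simp: pair_perm_def)
  then show ?thesis
    using pair_perm_permutes[OF assms] pair_perm_permutes[OF permutes_id, of S] permutation_UNIV
    by (metis mult_1 sign_compose sign_pair_perm_empty[OF assms] sign_pair_perm_id)
qed

lemma symplectic_form_coordinate_frame:
  "symplectic_form (coordinate_frame (i, b)) (coordinate_frame (j, c)) =
     (if i = j \<and> b \<noteq> c then if c then 1 else - 1 else 0)"
  by (cases b; cases c) (auto simp: symplectic_form_def coordinate_frame_def axis_def
      if_distrib[of "\<lambda>x. x * _"] if_distrib[of "\<lambda>x. _ * x"] sum_negf cong: if_cong)

text \<open>
  A permutation contributes only if it maps each pair \<open>{(i, False), (i, True)}\<close> to such a pair, that is,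
  if it is some \<open>pair_perm \<pi> S\<close>; then its sign cancels against the product.
\<close>

lemma symplectic_volume_form_coordinate_frame:
  "symplectic_volume_form (coordinate_frame :: 'n::finite \<times> bool \<Rightarrow> 'n phase) = fact CARD('n)"
proof -
  define f :: "('n \<times> bool \<Rightarrow> 'n \<times> bool) \<Rightarrow> real" where
    "f p = of_int (sign p) * (\<Prod>i\<in>UNIV. symplectic_form (coordinate_frame (p (i, False)))
      (coordinate_frame (p (i, True)) :: 'n phase))" for p
  define A :: "(('n \<Rightarrow> 'n) \<times> 'n set) set" where "A = {\<pi>. \<pi> permutes UNIV} \<times> UNIV"
  define g where "g = (\<lambda>(\<pi>, S :: 'n set). pair_perm \<pi> S)"
  have inj: "inj_on g A"
  proof (rule inj_onI)
    fix x y assume "g x = g y"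
    moreover obtain \<pi> S \<pi>' S' where xy: "x = (\<pi>, S)" "y = (\<pi>', S')" by fastforce
    ultimately have "pair_perm \<pi> S (i, False) = pair_perm \<pi>' S' (i, False)" for i
      by (simp add: g_def)
    then show "x = y"
      unfolding xy by (auto simp: pair_perm_def fun_eq_iff)
  qed
  have f1: "f (g x) = 1" if "x \<in> A" for x
  proof -
    obtain \<pi> S where x: "x = (\<pi>, S)" by fastforce
    then have \<pi>: "\<pi> permutes UNIV" using that by (simp add: A_def)
    have "(\<Prod>i\<in>UNIV. symplectic_form (coordinate_frame (pair_perm \<pi> S (i, False)))
      (coordinate_frame (pair_perm \<pi> S (i, True)) :: 'n phase)) = (\<Prod>i\<in>UNIV. if i \<in> S then - 1 else 1)"
      by (intro prod.cong) (auto simp: pair_perm_def symplectic_form_coordinate_frame)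
    also have "\<dots> = (-1) ^ card S"
      by (simp add: prod.If_cases)
    finally show ?thesis
      using sign_pair_perm[OF \<pi>, of S] by (simp add: f_def g_def x flip: power_mult_distrib)
  qed
  have "f p = 0" if p: "p permutes UNIV" "p \<notin> g ` A" for p
  proof -
    have "\<exists>i. fst (p (i, False)) \<noteq> fst (p (i, True))"
    proof (rule ccontr)
      assume "\<not> ?thesis"
      then have eq: "fst (p (i, True)) = fst (p (i, False))" for i by metis
      have inj: "inj p" using p permutes_inj by blast
      have snd: "snd (p (i, True)) = (\<not> snd (p (i, False)))" for i
        using eq[of i] injD[OF inj, of "(i, True)" "(i, False)"] by (auto simp: prod_eq_iff)
      define \<pi> where "\<pi> i = fst (p (i, False))" for i
      define S where "S = {i. snd (p (i, False))}"
      have p_eq: "p (i, b) = (\<pi> i, b \<noteq> (i \<in> S))" for i b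
        using eq[of i] snd[of i] by (cases b) (auto simp: \<pi>_def S_def prod_eq_iff)
      have "inj \<pi>"
      proof (rule injI)
        fix i j assume ij: "\<pi> i = \<pi> j"
        \<comment> \<open>The Boolean is chosen so that both images have second component
          \<open>False\<close>; equal first components then make the images equal.\<close>
        have "p (i, i \<in> S) = p (j, j \<in> S)"
          by (simp add: p_eq ij)
        from injD[OF inj this] show "i = j" by simp
      qed
      then have "\<pi> permutes UNIV"
        by (intro inj_imp_permutes) auto
      moreover have "p = g (\<pi>, S)"
        by (auto simp: g_def pair_perm_def p_eq)
      ultimately show False
        using p by (auto simp: A_def)
    qed
    then obtain i where i: "fst (p (i, False)) \<noteq> fst (p (i, True))" ..
    have "symplectic_form (coordinate_frame (p (i, False))) (coordinate_frame (p (i, True)) :: 'n phase) = 0"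
      using i by (cases "p (i, False)"; cases "p (i, True)") (simp add: symplectic_form_coordinate_frame)
    then show ?thesis
      unfolding f_def by (auto simp: prod_zero_iff)
  qed
  moreover have "g ` A \<subseteq> {p. p permutes UNIV}"
    by (auto simp: g_def A_def pair_perm_permutes)
  ultimately have "(\<Sum>p | p permutes UNIV. f p) = (\<Sum>p\<in>g ` A. f p)"
    by (intro sum.mono_neutral_right) (auto simp: finite_permutations)
  also have "\<dots> = (\<Sum>x\<in>A. 1)"
    using f1 by (simp add: sum.reindex[OF inj])
  \<comment> \<open>There are m! choices of \<open>\<pi>\<close> and 2^m of S; the latter factor
    cancels the normalisation of the wedge power.\<close>
  also have "\<dots> = fact CARD('n) * 2 ^ CARD('n)"
    by (simp add: A_def card_cartesian_product card_permutations card_Pow flip: Pow_UNIV)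
  finally show ?thesis
    unfolding symplectic_volume_form_def by (simp add: f_def)
qed

section \<open>Rotation-invariant ball packings\<close>

definition first_coord :: "'n::finite \<Rightarrow> 'n phase \<Rightarrow> complex" where
  "first_coord i z = Complex (fst z $ i) (snd z $ i)"

lemma first_coord_rot: "first_coord i (rot \<beta> z) = cis \<beta> * first_coord i z"
  by (simp add: first_coord_def rot_def cJ_def complex_eq_iff algebra_simps)

lemma continuous_on_first_coord: "continuous_on S (first_coord i)"
  unfolding first_coord_def[abs_def] by (intro continuous_intros)

lemma rot_image_ball: "rot \<beta> ` ball c a = ball (rot \<beta> c) a"
proof (intro equalityI subsetI)
  fix x assume "x \<in> ball (rot \<beta> c) a"
  then have "rot (- \<beta>) x \<in> ball c a"
    using dist_rot[of "- \<beta>" "rot \<beta> c" x] by (simp add: rot_add)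
  moreover have "x = rot \<beta> (rot (- \<beta>) x)" by (simp add: rot_add)
  ultimately show "x \<in> rot \<beta> ` ball c a" by blast
qed auto

lemma mem_ball_rot: "rot \<beta> x \<in> ball (rot \<beta> c) a \<longleftrightarrow> x \<in> ball c a"
  by simp

section \<open>The sector as a fundamental domain of the rotation, up to a null set\<close>

text \<open>\<open>Arg2pi\<close> takes values from 0 inclusive to 2 pi exclusive and is 0 at 0. The
  strict lower bound therefore makes the sector open and keeps it away from the origin, the common
  fixed point of all rotations.\<close>

definition sector :: "'n::finite \<Rightarrow> real \<Rightarrow> 'n phase set" where
  "sector i \<alpha> = {z. 0 < Arg2pi (first_coord i z) \<and> Arg2pi (first_coord i z) < \<alpha>}"

lemma open_sector:
  assumes "\<alpha> \<le> 2 * pi"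
  shows "open (sector i \<alpha>)"
proof -
  have "sector i \<alpha> = first_coord i -` ({y. 0 < Arg2pi y} \<inter> {y. Arg2pi y < \<alpha>})"
    by (auto simp: sector_def)
  then show ?thesis
    using open_vimage[OF open_Arg2pi2pi_less_Int[OF order_refl assms] continuous_on_first_coord] by simp
qed

lemma sector_nonzero: "z \<in> sector i \<alpha> \<Longrightarrow> z \<noteq> 0"
  by (auto simp: sector_def first_coord_def simp flip: zero_complex.code)

lemma Arg2pi_cis_mult:
  assumes "w \<noteq> 0" "0 \<le> Arg2pi w + \<beta>" "Arg2pi w + \<beta> < 2 * pi"
  shows "Arg2pi (cis \<beta> * w) = Arg2pi w + \<beta>"
proof (rule Arg2pi_unique[of "cmod w"])
  have "w = of_real (cmod w) * cis (Arg2pi w)"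
    using Arg2pi_eq[of w] by (simp add: cis_conv_exp)
  then show "of_real (cmod w) * exp (\<i> * of_real (Arg2pi w + \<beta>)) = cis \<beta> * w"
    by (metis cis_conv_exp cis_mult mult.commute mult.left_commute)
qed (use assms in auto)

text \<open>For k < n the argument shifts by k alpha without passing 2 pi. A common image point
  would make two arguments of size between 0 and alpha differ by a nonzero multiple of
  alpha.\<close>

lemma sector_rotations_disjoint:
  assumes "n > 0" "k < n" "l < n" "k \<noteq> l"
    and "z \<in> sector i (2 * pi / real n)" "w \<in> sector i (2 * pi / real n)"
  shows "rot (real k * (2 * pi / real n)) z \<noteq> rot (real l * (2 * pi / real n)) w"
proof
  define \<alpha> where "\<alpha> = 2 * pi / real n"
  assume eq: "rot (real k * (2 * pi / real n)) z = rot (real l * (2 * pi / real n)) w"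
  have n\<alpha>: "real n * \<alpha> = 2 * pi" and \<alpha>: "\<alpha> > 0"
    using assms(1) by (simp_all add: \<alpha>_def)
  have Arg: "Arg2pi (first_coord i (rot (real k * \<alpha>) z)) = Arg2pi (first_coord i z) + real k * \<alpha>"
    if "z \<in> sector i \<alpha>" "k < n" for z k
  proof -
    have a: "0 < Arg2pi (first_coord i z)" "Arg2pi (first_coord i z) < \<alpha>"
      using that by (auto simp: sector_def)
    have "(real k + 1) * \<alpha> \<le> real n * \<alpha>"
      using that \<alpha> by (intro mult_right_mono) auto
    then have "Arg2pi (first_coord i z) + real k * \<alpha> < 2 * pi"
      using a n\<alpha> by (simp add: algebra_simps)
    moreover have "first_coord i z \<noteq> 0" using a by auto
    ultimately show ?thesis
      unfolding first_coord_rot using a \<alpha> by (intro Arg2pi_cis_mult) auto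
  qed
  have a: "0 < Arg2pi (first_coord i z)" "Arg2pi (first_coord i z) < \<alpha>"
    "0 < Arg2pi (first_coord i w)" "Arg2pi (first_coord i w) < \<alpha>"
    using assms by (auto simp: sector_def \<alpha>_def)
  have "Arg2pi (first_coord i z) + real k * \<alpha> = Arg2pi (first_coord i w) + real l * \<alpha>"
    using Arg[of z k] Arg[of w l] eq assms by (simp add: \<alpha>_def)
  then have "\<bar>(real k - real l) * \<alpha>\<bar> < \<alpha>"
    using a by (simp add: algebra_simps)
  then have "\<bar>real k - real l\<bar> < 1"
    using \<alpha> by (simp add: abs_mult)
  with \<open>k \<noteq> l\<close> show False by linarith
qed

lemma sector_rotations_cover:
  fixes i :: "'n::finite"
  assumes "n > 0"
  obtains N where "negligible N"
    "\<And>z :: 'n phase. z \<notin> N \<Longrightarrow> \<exists>k<n. rot (- (real k * (2 * pi / real n))) z \<in> sector i (2 * pi / real n)"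
proof -
  define \<alpha> where "\<alpha> = 2 * pi / real n"
  have n\<alpha>: "real n * \<alpha> = 2 * pi" and \<alpha>: "\<alpha> > 0"
    using assms(1) by (simp_all add: \<alpha>_def)
  \<comment> \<open>The points with y_i = 0. This contains the boundary ray Arg = 0 and is a linear
    hyperplane, hence a null set with null images under rotations.\<close>
  define H :: "'n phase set" where "H = {z. (0, axis i 1) \<bullet> z = 0}"
  define N where "N = (\<Union>k<n. rot (real k * \<alpha>) ` H)"
  have "(0, axis i 1) \<noteq> (0 :: 'n phase)"
    by (simp add: zero_prod_def axis_eq_0_iff)
  then have H: "negligible H"
    unfolding H_def by (intro negligible_hyperplane) simp
  show ?thesis
  proof (rule that)
    show "negligible N"
      unfolding N_def
      by (intro negligible_Union finite_imageI)
         (auto intro!: negligible_differentiable_image_negligible[OF order_refl H]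
            linear_imp_differentiable_on linear_rot)
    fix z :: "'n phase" assume z: "z \<notin> N"
    define w where "w = first_coord i z"
    \<comment> \<open>The sector containing z is found by dividing its argument by alpha and
      rounding down.\<close>
    define k where "k = nat \<lfloor>Arg2pi w / \<alpha>\<rfloor>"
    have "0 \<le> Arg2pi w / \<alpha>" using \<alpha> Arg2pi_ge_0[of w] by simp
    then have k: "real k = of_int \<lfloor>Arg2pi w / \<alpha>\<rfloor>" by (simp add: k_def)
    have "Arg2pi w / \<alpha> < real n"
      using Arg2pi_lt_2pi[of w] \<alpha> by (simp add: divide_less_eq n\<alpha>)
    then have "real k < real n" using k by linarith
    then have kn: "k < n" by simp
    have k1: "real k * \<alpha> \<le> Arg2pi w"
      using \<alpha> k by (metis of_int_floor_le pos_le_divide_eq)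
    have "Arg2pi w / \<alpha> < real k + 1" using k by linarith
    then have k2: "Arg2pi w < real k * \<alpha> + \<alpha>"
      using \<alpha> by (simp add: divide_less_eq algebra_simps)
    define z' where "z' = rot (- (real k * \<alpha>)) z"
    have "z = rot (real k * \<alpha>) z'" by (simp add: z'_def rot_add)
    then have "z' \<notin> H" using z kn by (auto simp: N_def)
    then have Im: "Im (first_coord i z') \<noteq> 0"
      by (simp add: H_def first_coord_def inner_prod_def inner_axis' )
    have fz': "first_coord i z' = cis (- (real k * \<alpha>)) * w"
      by (simp add: z'_def first_coord_rot w_def)
    have "w \<noteq> 0" using Im fz' by auto
    then have Arg: "Arg2pi (first_coord i z') = Arg2pi w - real k * \<alpha>"
      unfolding fz' using Arg2pi_cis_mult[of w "- (real k * \<alpha>)"] k1 \<alpha> Arg2pi_lt_2pi[of w]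
      by (smt (verit) mult_nonneg_nonneg of_nat_0_le_iff)
    have "Arg2pi (first_coord i z') \<noteq> 0"
      using Im by (simp add: Arg2pi_eq_0 complex_is_Real_iff)
    then have "z' \<in> sector i \<alpha>"
      using Arg k1 k2 by (simp add: sector_def)
    then show "\<exists>k<n. rot (- (real k * (2 * pi / real n))) z \<in> sector i (2 * pi / real n)"
      using kn unfolding z'_def \<alpha>_def by blast
  qed
qed

text \<open>Vitali's theorem is applied to all balls of radius at most \<eta> whose closure lies in
  the open set. Asking for closed balls inside the unit ball gives norm c + a < 1, so that a finite
  subfamily lies in a strictly smaller ball.\<close>

lemma sector_ball_packing:
  fixes i :: "'n::finite"
  assumes "\<alpha> \<le> 2 * pi" "\<eta> > 0"
  obtains C :: "('n phase \<times> real) set" where "countable C"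
    "\<And>c a. (c, a) \<in> C \<Longrightarrow> 0 < a \<and> a \<le> \<eta> \<and> ball c a \<subseteq> sector i \<alpha> \<and> cball c a \<subseteq> ball 0 1"
    "\<And>c a c' a'. (c, a) \<in> C \<Longrightarrow> (c', a') \<in> C \<Longrightarrow> (c, a) \<noteq> (c', a') \<Longrightarrow> ball c a \<inter> ball c' a' = {}"
    "negligible (sector i \<alpha> \<inter> ball 0 1 - (\<Union>(c, a)\<in>C. ball c a))"
proof -
  define S :: "'n phase set" where "S = sector i \<alpha> \<inter> ball 0 1"
  have "open S" unfolding S_def using open_sector[OF assms(1)] by blast
  define K where "K = {(c, a). 0 < a \<and> a \<le> \<eta> \<and> cball c a \<subseteq> S}"
  have cov: "\<exists>j. j \<in> K \<and> x \<in> ball (fst j) (snd j) \<and> snd j < d" if "x \<in> S" "0 < d" for x d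
  proof -
    obtain e where e: "e > 0" "cball x e \<subseteq> S"
      using \<open>open S\<close> \<open>x \<in> S\<close> open_contains_cball by blast
    \<comment> \<open>The three bounds keep the ball in S, cap the radius by \<eta>, and meet the
      strict fineness condition \<open>snd j < d\<close>.\<close>
    define a where "a = min e (min \<eta> (d / 2))"
    have "cball x a \<subseteq> S" "0 < a" "a \<le> \<eta>" "a < d"
      using e that assms by (auto simp: a_def)
    then show ?thesis
      by (intro exI[of _ "(x, a)"]) (auto simp: K_def)
  qed
  obtain C where C: "countable C" "C \<subseteq> K"
     "pairwise (\<lambda>i j. disjnt (ball (fst i) (snd i)) (ball (fst j) (snd j))) C"
     "negligible (S - (\<Union>i\<in>C. ball (fst i) (snd i)))"
    by (rule Vitali_covering_theorem_balls[of S K fst snd, OF cov]) (assumption | rule that)+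
  show ?thesis
  proof (rule that[OF C(1)])
    fix c a assume ca: "(c, a) \<in> C"
    then have K: "0 < a" "a \<le> \<eta>" "cball c a \<subseteq> S"
      using C(2) by (auto simp: K_def)
    moreover have "ball c a \<subseteq> cball c a" by (rule ball_subset_cball)
    ultimately show "0 < a \<and> a \<le> \<eta> \<and> ball c a \<subseteq> sector i \<alpha> \<and> cball c a \<subseteq> ball 0 1"
      unfolding S_def by blast
    fix c' a' assume "(c', a') \<in> C" "(c, a) \<noteq> (c', a')"
    then show "ball c a \<inter> ball c' a' = {}"
      using pairwiseD[OF C(3) ca, of "(c', a')"] by (simp add: disjnt_def)
  next
    show "negligible (sector i \<alpha> \<inter> ball 0 1 - (\<Union>(c, a)\<in>C. ball c a))"
      using C(4) by (simp add: S_def case_prod_unfold)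
  qed
qed

text \<open>The part of the ball missed by all rotated copies is covered by \<open>N\<close> and by
  rotated copies of a null set, so the countable family has full measure. Truncating an enumeration
  of C gives an increasing union, and continuity from below makes a finite truncation
  suffice.\<close>

lemma rotated_packing_measure:
  fixes i :: "'n::finite"
  assumes "n > 0" "e > 0" and C: "countable C"
    "\<And>c a. (c, a) \<in> C \<Longrightarrow> cball c a \<subseteq> ball 0 1"
    "negligible (sector i (2 * pi / real n) \<inter> ball 0 1 - (\<Union>(c, a)\<in>C. ball c a))"
  obtains C' :: "('n phase \<times> real) set" where "finite C'" "C' \<subseteq> C"
    "measure lebesgue (\<Union>k<n. \<Union>(c, a)\<in>C'. ball (rot (real k * (2 * pi / real n)) c) a)
      > measure lebesgue (ball 0 1 :: 'n phase set) - e"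
proof -
  define \<alpha> where "\<alpha> = 2 * pi / real n"
  define U where "U = (\<lambda>D :: ('n phase \<times> real) set. \<Union>k<n. \<Union>(c, a)\<in>D. ball (rot (real k * \<alpha>) c) a)"
  define M where "M = sector i \<alpha> \<inter> ball 0 1 - (\<Union>(c, a)\<in>C. ball c a)"
  obtain N where N: "negligible N"
    "\<And>z :: 'n phase. z \<notin> N \<Longrightarrow> \<exists>k<n. rot (- (real k * \<alpha>)) z \<in> sector i \<alpha>"
    by (rule sector_rotations_cover[OF assms(1), of i, folded \<alpha>_def]) (rule that)
  have sub: "ball 0 1 - U C \<subseteq> N \<union> (\<Union>k<n. rot (real k * \<alpha>) ` M)"
  proof
    fix z assume z: "z \<in> ball 0 1 - U C"
    show "z \<in> N \<union> (\<Union>k<n. rot (real k * \<alpha>) ` M)"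
    proof (cases "z \<in> N")
      case False
      then obtain k where k: "k < n" "rot (- (real k * \<alpha>)) z \<in> sector i \<alpha>"
        using N by blast
      let ?z = "rot (- (real k * \<alpha>)) z"
      have zz: "z = rot (real k * \<alpha>) ?z" by (simp add: rot_add)
      have "?z \<notin> ball c a" if "(c, a) \<in> C" for c a
      proof
        assume "?z \<in> ball c a"
        then have "z \<in> ball (rot (real k * \<alpha>) c) a"
          using mem_ball_rot[of "real k * \<alpha>" ?z c a] zz by simp
        then have "z \<in> U C" using that k unfolding U_def by blast
        with z show False by simp
      qed
      then have "?z \<in> M"
        using k z by (auto simp: M_def)
      then show ?thesis using zz k by blast
    qed simp
  qed
  have "negligible (\<Union>k<n. rot (real k * \<alpha>) ` M)"
    using C(3) unfolding M_def[symmetric] \<alpha>_def[symmetric]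
    by (intro negligible_Union finite_imageI)
       (auto intro!: negligible_differentiable_image_negligible[OF order_refl]
            linear_imp_differentiable_on linear_rot)
  then have neg: "negligible (ball 0 1 - U C)"
    using N(1) sub by (meson negligible_Un negligible_subset)
  have UC: "U C \<subseteq> ball 0 1"
  proof -
    have "ball (rot \<beta> c) a \<subseteq> ball 0 1" if "(c, a) \<in> C" for c a \<beta>
    proof -
      have "ball c a \<subseteq> ball 0 1"
        using C(2)[OF that] ball_subset_cball by blast
      then show ?thesis unfolding rot_image_ball[symmetric] by auto
    qed
    then show ?thesis unfolding U_def by blast
  qed
  have "measure lebesgue (U C) = measure lebesgue (ball 0 1 :: 'n phase set)"
    using UC neg by (intro measure_negligible_symdiff) (simp_all add: Diff_eq_empty_iff[THEN iffD2])
  moreover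
  define C' where "C' = (\<lambda>j. {x \<in> C. to_nat_on C x < j})"
  have UC': "U C = (\<Union>j. U (C' j))"
    unfolding U_def C'_def by (auto simp: case_prod_unfold)
  have opn: "open (U D)" for D
    unfolding U_def by (simp add: case_prod_unfold open_UN)
  have "(\<lambda>j. measure lebesgue (U (C' j))) \<longlonglongrightarrow> measure lebesgue (\<Union>j. U (C' j))"
  proof (rule Lim_measure_incseq)
    show "range (\<lambda>j. U (C' j)) \<subseteq> sets lebesgue"
      using opn by auto
    show "incseq (\<lambda>j. U (C' j))"
      unfolding incseq_def U_def C'_def by force
    have "U C \<in> lmeasurable"
      using opn UC bounded_ball bounded_subset lmeasurable_open by blast
    then show "emeasure lebesgue (\<Union>j. U (C' j)) \<noteq> \<infinity>"
      unfolding UC'[symmetric] by (metis fmeasurableD2 infinity_ennreal_def)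
  qed
  ultimately have "(\<lambda>j. measure lebesgue (U (C' j))) \<longlonglongrightarrow> measure lebesgue (ball 0 1 :: 'n phase set)"
    using UC' by simp
  from order_tendstoD(1)[OF this, of "measure lebesgue (ball 0 1 :: 'n phase set) - e"] \<open>e > 0\<close>
  obtain j where j: "measure lebesgue (U (C' j)) > measure lebesgue (ball 0 1 :: 'n phase set) - e"
    by (auto simp: eventually_sequentially)
  have "finite (C' j)"
    unfolding C'_def
    by (rule finite_imageD[of "to_nat_on C"])
       (auto intro: finite_subset[of _ "{..<j}"] inj_on_subset[OF inj_on_to_nat_on[OF C(1)]])
  then show ?thesis
    using that[of "C' j"] j unfolding U_def \<alpha>_def C'_def by auto
qed

lemma rot_2pi: "rot (2 * pi) z = z"
  by (simp add: rot_def)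

text \<open>Taking all n rotated copies of a finite family makes it invariant. Copies in different
  rotated sectors are disjoint because the sectors are, copies in the same one because the original
  balls are.\<close>

lemma rotation_invariant_ball_packing:
  assumes "n > 0" "\<eta> > 0" "e > 0"
  obtains F :: "('n::finite phase \<times> real) set" and r where "finite F" "0 < r" "r < 1"
    "\<And>c a. (c, a) \<in> F \<Longrightarrow> 0 < a \<and> a \<le> \<eta> \<and> ball c a \<subseteq> ball 0 r \<and> c \<noteq> 0"
    "\<And>c a. (c, a) \<in> F \<Longrightarrow> (rot (2 * pi / real n) c, a) \<in> F"
    "\<And>c a. (c, a) \<in> F \<Longrightarrow> (rot (- (2 * pi / real n)) c, a) \<in> F"
    "\<And>c a c' a'. (c, a) \<in> F \<Longrightarrow> (c', a') \<in> F \<Longrightarrow> (c, a) \<noteq> (c', a') \<Longrightarrow> ball c a \<inter> ball c' a' = {}"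
    "measure lebesgue (\<Union>(c, a)\<in>F. ball c a) > measure lebesgue (ball 0 1 :: 'n phase set) - e"
proof -
  define \<alpha> where "\<alpha> = 2 * pi / real n"
  have n\<alpha>: "real n * \<alpha> = 2 * pi"
    using assms(1) by (simp add: \<alpha>_def)
  have "\<alpha> \<le> 2 * pi"
    using assms(1) by (simp add: \<alpha>_def divide_le_eq)
  fix i :: 'n
  obtain C :: "('n phase \<times> real) set" where C: "countable C"
    "\<And>c a. (c, a) \<in> C \<Longrightarrow> 0 < a \<and> a \<le> \<eta> \<and> ball c a \<subseteq> sector i \<alpha> \<and> cball c a \<subseteq> ball 0 1"
    "\<And>c a c' a'. (c, a) \<in> C \<Longrightarrow> (c', a') \<in> C \<Longrightarrow> (c, a) \<noteq> (c', a') \<Longrightarrow> ball c a \<inter> ball c' a' = {}"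
    "negligible (sector i \<alpha> \<inter> ball 0 1 - (\<Union>(c, a)\<in>C. ball c a))"
    by (rule sector_ball_packing[OF \<open>\<alpha> \<le> 2 * pi\<close> \<open>\<eta> > 0\<close>]) (rule that)
  obtain D where D: "finite D" "D \<subseteq> C"
    "measure lebesgue (\<Union>k<n. \<Union>(c, a)\<in>D. ball (rot (real k * \<alpha>) c) a)
      > measure lebesgue (ball 0 1 :: 'n phase set) - e"
    by (rule rotated_packing_measure[OF assms(1,3) C(1) _ C(4)[unfolded \<alpha>_def], folded \<alpha>_def])
       (use C(2) in blast, rule that)
  define F where "F = (\<lambda>(k, c, a). (rot (real k * \<alpha>) c, a)) ` ({..<n} \<times> D)"
  have FI: "(rot (real k * \<alpha>) c, a) \<in> F" if "k < n" "(c, a) \<in> D" for k c a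
    unfolding F_def using that by force
  have FE: "\<exists>k c. x = rot (real k * \<alpha>) c \<and> k < n \<and> (c, a) \<in> D" if "(x, a) \<in> F" for x a
    using that unfolding F_def by auto
  have "finite F" using D by (simp add: F_def)
  have rng: "0 < a \<and> a \<le> \<eta> \<and> norm x + a < 1 \<and> x \<noteq> 0" if xa: "(x, a) \<in> F" for x a
  proof -
    obtain k c where kc: "x = rot (real k * \<alpha>) c" "k < n" "(c, a) \<in> D"
      using FE[OF xa] by blast
    with C(2) D(2) have *: "0 < a" "a \<le> \<eta>" "ball c a \<subseteq> sector i \<alpha>" "cball c a \<subseteq> ball 0 1"
      by blast+
    then have "c \<in> sector i \<alpha>" by auto
    then have "c \<noteq> 0" using sector_nonzero by blast
    moreover have "norm c + a < 1"
      using *(1,4) by (simp add: cball_subset_ball_iff)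
    ultimately show ?thesis
      using * kc by (metis norm_eq_zero norm_rot)
  qed
  \<comment> \<open>The entry 1/2 keeps r positive and the maximum defined even when F is
    empty.\<close>
  define r where "r = Max (insert (1 / 2) ((\<lambda>(x, a). norm x + a) ` F))"
  have r: "0 < r" "r < 1" "\<And>x a. (x, a) \<in> F \<Longrightarrow> norm x + a \<le> r"
  proof -
    have fin: "finite (insert (1 / 2) ((\<lambda>(x, a). norm x + a) ` F))"
      using \<open>finite F\<close> by simp
    have "1 / 2 \<le> r" unfolding r_def by (rule Max_ge[OF fin]) simp
    then show "0 < r" by simp
    show "r < 1" unfolding r_def using fin rng by (subst Max_less_iff) auto
    show "norm x + a \<le> r" if "(x, a) \<in> F" for x a
      unfolding r_def by (rule Max_ge[OF fin]) (use that in force)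
  qed
  show ?thesis
  proof (rule that[OF \<open>finite F\<close> r(1,2)])
    fix x a assume xa: "(x, a) \<in> F"
    have "ball x a \<subseteq> ball 0 r"
      using r(3)[OF xa] by (simp add: ball_subset_ball_iff)
    then show "0 < a \<and> a \<le> \<eta> \<and> ball x a \<subseteq> ball 0 r \<and> x \<noteq> 0"
      using rng[OF xa] by blast
    obtain k c where kc: "x = rot (real k * \<alpha>) c" "k < n" "(c, a) \<in> D"
      using FE[OF xa] by blast
    \<comment> \<open>Indices are cyclic: after n - 1 comes 0, because n alpha = 2 pi. The inverse
      rotation below wraps from 0 to n - 1 in the same way.\<close>
    have R: "rot \<alpha> x = rot (real (if Suc k = n then 0 else Suc k) * \<alpha>) c"
    proof (cases "Suc k = n")
      case True
      have "rot \<alpha> x = rot (real n * \<alpha>) c"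
        unfolding kc(1) rot_add True[symmetric] by (simp add: algebra_simps)
      then show ?thesis using True n\<alpha> by (simp add: rot_2pi)
    next
      case False
      then show ?thesis unfolding kc(1) rot_add by (simp add: algebra_simps)
    qed
    show "(rot (2 * pi / real n) x, a) \<in> F"
      unfolding \<alpha>_def[symmetric] R by (rule FI[OF _ kc(3)]) (use kc(2) assms(1) in auto)
    have R: "rot (- \<alpha>) x = rot (real (if k = 0 then n - 1 else k - 1) * \<alpha>) c"
    proof (cases "k = 0")
      case True
      have "rot (- \<alpha>) c = rot (- \<alpha>) (rot (2 * pi) c)" by (simp add: rot_2pi)
      then show ?thesis
        using True assms(1) kc by (simp add: rot_add of_nat_diff left_diff_distrib n\<alpha>)
    next
      case False
      then show ?thesis unfolding kc(1) rot_add by (simp add: of_nat_diff left_diff_distrib)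
    qed
    show "(rot (- (2 * pi / real n)) x, a) \<in> F"
      unfolding \<alpha>_def[symmetric] R by (rule FI[OF _ kc(3)]) (use kc(2) assms(1) in auto)
    fix x' a' assume xa': "(x', a') \<in> F" and ne: "(x, a) \<noteq> (x', a')"
    obtain l c' where lc: "x' = rot (real l * \<alpha>) c'" "l < n" "(c', a') \<in> D"
      using FE[OF xa'] by blast
    show "ball x a \<inter> ball x' a' = {}"
    proof (rule ccontr)
      assume "ball x a \<inter> ball x' a' \<noteq> {}"
      then obtain y z where yz: "y \<in> ball c a" "z \<in> ball c' a'"
        "rot (real k * \<alpha>) y = rot (real l * \<alpha>) z"
        unfolding kc(1) lc(1) rot_image_ball[symmetric] by blast
      have "y \<in> sector i \<alpha>" "z \<in> sector i \<alpha>"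
        using yz C(2) D(2) kc(3) lc(3) by blast+
      with yz(3) sector_rotations_disjoint[OF assms(1) kc(2) lc(2)] have "k = l"
        unfolding \<alpha>_def by blast
      with yz(3) have "rot (- (real k * \<alpha>)) (rot (real k * \<alpha>) y) = rot (- (real k * \<alpha>)) (rot (real k * \<alpha>) z)"
        by simp
      then have "y = z" by (simp add: rot_add)
      with yz C(3)[of c a c' a'] D(2) kc(3) lc(3) have "(c, a) = (c', a')"
        by blast
      with \<open>k = l\<close> ne kc(1) lc(1) show False by simp
    qed
  next
    have "(\<Union>(c, a)\<in>F. ball c a) = (\<Union>k<n. \<Union>(c, a)\<in>D. ball (rot (real k * \<alpha>) c) a)"
      unfolding F_def by (auto simp: case_prod_unfold) force+
    then show "measure lebesgue (\<Union>(c, a)\<in>F. ball c a) > measure lebesgue (ball 0 1 :: 'n phase set) - e"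
      using D(3) by simp
  qed
qed

section \<open>The construction\<close>

text \<open>A summary of what the main construction needs from the twists. Here k is the fraction of
  each radius on which the full angle is reached, and the tolerance a bounds the action term caused
  by the centre not being the origin.\<close>

definition ball_twists ::
  "real \<Rightarrow> real \<Rightarrow> ('n::finite phase \<times> real) set \<Rightarrow> (real \<Rightarrow> 'n phase \<Rightarrow> 'n phase) \<Rightarrow>
     (real \<Rightarrow> 'n phase \<Rightarrow> real) \<Rightarrow> bool" where
  "ball_twists k L F \<psi> \<tau> \<longleftrightarrow> exact_isotopy \<psi> \<tau>
     \<and> (\<forall>t z. z \<notin> (\<Union>(c, a)\<in>F. ball c a) \<longrightarrow> \<psi> t z = z \<and> \<tau> t z = 0)
     \<and> (\<forall>t c a z. (c, a) \<in> F \<longrightarrow> z \<in> ball c a \<longrightarrow> \<psi> t z \<in> ball c a)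
     \<and> (\<forall>t c a z. (c, a) \<in> F \<longrightarrow> z \<in> ball c a \<longrightarrow> 0 \<le> t \<longrightarrow> t \<le> 1 \<longrightarrow> - L - a \<le> \<tau> t z \<and> \<tau> t z \<le> a)
     \<and> (\<forall>c a z. (c, a) \<in> F \<longrightarrow> z \<in> ball c (k * a) \<longrightarrow> \<tau> 1 z \<le> a - k\<^sup>2 * L)"

lemma ball_twistsI:
  assumes "exact_isotopy \<psi> \<tau>"
    and "\<And>t z. z \<notin> (\<Union>(c, a)\<in>F. ball c a) \<Longrightarrow> \<psi> t z = z \<and> \<tau> t z = 0"
    and "\<And>t c a z. (c, a) \<in> F \<Longrightarrow> z \<in> ball c a \<Longrightarrow> \<psi> t z \<in> ball c a"
    and "\<And>t c a z. (c, a) \<in> F \<Longrightarrow> z \<in> ball c a \<Longrightarrow> 0 \<le> t \<Longrightarrow> t \<le> 1 \<Longrightarrow> - L - a \<le> \<tau> t z \<and> \<tau> t z \<le> a"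
    and "\<And>c a z. (c, a) \<in> F \<Longrightarrow> z \<in> ball c (k * a) \<Longrightarrow> \<tau> 1 z \<le> a - k\<^sup>2 * L"
  shows "ball_twists k L F \<psi> \<tau>"
  unfolding ball_twists_def using assms by (intro conjI allI impI) blast+

lemma ball_twistsD:
  assumes "ball_twists k L F \<psi> \<tau>"
  shows "exact_isotopy \<psi> \<tau>"
    and "z \<notin> (\<Union>(c, a)\<in>F. ball c a) \<Longrightarrow> \<psi> t z = z"
    and "z \<notin> (\<Union>(c, a)\<in>F. ball c a) \<Longrightarrow> \<tau> t z = 0"
    and "(c, a) \<in> F \<Longrightarrow> z \<in> ball c a \<Longrightarrow> \<psi> t z \<in> ball c a"
    and "(c, a) \<in> F \<Longrightarrow> z \<in> ball c a \<Longrightarrow> 0 \<le> t \<Longrightarrow> t \<le> 1 \<Longrightarrow> - L - a \<le> \<tau> t z"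
    and "(c, a) \<in> F \<Longrightarrow> z \<in> ball c a \<Longrightarrow> 0 \<le> t \<Longrightarrow> t \<le> 1 \<Longrightarrow> \<tau> t z \<le> a"
    and "(c, a) \<in> F \<Longrightarrow> z \<in> ball c (k * a) \<Longrightarrow> \<tau> 1 z \<le> a - k\<^sup>2 * L"
  using assms unfolding ball_twists_def by (elim conjE; blast)+

lemma ball_twist_exists:
  fixes c :: "'n::finite phase"
  assumes k: "0 < k" "k < 1" and "L \<ge> 0" and a: "0 < a" and r: "ball c a \<subseteq> ball 0 r" "r < 1"
  shows "\<exists>\<psi> \<tau>. ball_twists k L {(c, a)} \<psi> \<tau>"
proof -
  obtain u h where iso: "\<And>A. exact_isotopy (\<lambda>t z. c + rot (t * A * u (norm (z - c))) (z - c))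
      (\<lambda>t z. t * A * h (norm (z - c)) + cJ c \<bullet> (c + rot (t * A * u (norm (z - c))) (z - c) - z) / 2)"
    and u: "\<And>s. 0 \<le> u s" "\<And>s. u s \<le> 1" "\<And>s. 0 \<le> s \<Longrightarrow> s \<le> k * a \<Longrightarrow> u s = 1" "\<And>s. s \<ge> a \<Longrightarrow> u s = 0"
    and h: "\<And>s. s \<ge> a \<Longrightarrow> h s = 0" "\<And>s. 0 \<le> h s" "\<And>s. h s \<le> a\<^sup>2 / 2"
    "\<And>s. 0 \<le> s \<Longrightarrow> s \<le> k * a \<Longrightarrow> h s \<ge> (k * a)\<^sup>2 / 2"
    by (rule twist_isotopy[OF k a r]) (rule that)
  \<comment> \<open>Since h takes values from 0 to a^2/2, this amplitude turns its range into the
    interval from -L to 0; on the inner ball of radius k a, where h >= (k a)^2/2, the value is at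
    most -k^2 L.\<close>
  define A where "A = - (2 * L / a\<^sup>2)"
  define \<psi> where "\<psi> = (\<lambda>t z. c + rot (t * A * u (norm (z - c))) (z - c))"
  define \<tau> where "\<tau> = (\<lambda>t z. t * A * h (norm (z - c)) + cJ c \<bullet> (\<psi> t z - z) / 2)"
  have ball: "\<psi> t z \<in> ball c a" if "z \<in> ball c a" for t z
    using that by (simp add: \<psi>_def dist_norm norm_minus_commute)
  have cn: "norm c \<le> 1"
  proof -
    have "c \<in> ball 0 r" using a r by (meson centre_in_ball subsetD)
    then show ?thesis using r by simp
  qed
  \<comment> \<open>The off-centre term: \<open>cJ c\<close> has norm at most 1, both points lie in
    a ball of radius a and are at most 2a apart, and the factor 1/2 leaves a.\<close>
  have lin: "\<bar>cJ c \<bullet> (\<psi> t z - z) / 2\<bar> \<le> a" if z: "z \<in> ball c a" for t z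
  proof -
    have "norm (\<psi> t z - z) \<le> dist (\<psi> t z) c + dist c z"
      by (metis dist_norm dist_triangle)
    then have "norm (\<psi> t z - z) \<le> 2 * a"
      using z ball[OF z, of t] by (simp add: dist_commute)
    moreover have "\<bar>cJ c \<bullet> (\<psi> t z - z)\<bar> \<le> 1 * norm (\<psi> t z - z)"
      using Cauchy_Schwarz_ineq2[of "cJ c" "\<psi> t z - z"] mult_right_mono[OF cn norm_ge_zero[of "\<psi> t z - z"]]
      by simp
    ultimately show ?thesis by simp
  qed
  have "ball_twists k L {(c, a)} \<psi> \<tau>"
  proof (rule ball_twistsI)
    show "exact_isotopy \<psi> \<tau>"
      using iso[of A] unfolding \<tau>_def \<psi>_def .
    show "\<psi> t z = z \<and> \<tau> t z = 0" if "z \<notin> (\<Union>(c, a)\<in>{(c, a)}. ball c a)" for t z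
    proof -
      have "norm (z - c) \<ge> a" using that by (simp add: dist_norm norm_minus_commute)
      then have "u (norm (z - c)) = 0" "h (norm (z - c)) = 0" using u h by auto
      then show ?thesis by (simp add: \<tau>_def \<psi>_def)
    qed
    show "\<psi> t z \<in> ball c' a'" if "(c', a') \<in> {(c, a)}" "z \<in> ball c' a'" for t c' a' z
      using that ball by simp
    show "- L - a' \<le> \<tau> t z \<and> \<tau> t z \<le> a'"
      if "(c', a') \<in> {(c, a)}" "z \<in> ball c' a'" "0 \<le> t" "t \<le> 1" for t c' a' z
    proof -
      have "t * h (norm (z - c)) \<le> 1 * (a\<^sup>2 / 2)"
        using that h by (intro mult_mono) auto
      then have "(2 * L / a\<^sup>2) * (t * h (norm (z - c))) \<le> (2 * L / a\<^sup>2) * (a\<^sup>2 / 2)"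
        using \<open>L \<ge> 0\<close> by (intro mult_left_mono) auto
      also have "\<dots> = L" using a by simp
      finally have "- L \<le> t * A * h (norm (z - c))"
        by (simp add: A_def mult.assoc mult.left_commute)
      moreover have "t * A * h (norm (z - c)) \<le> 0"
        using \<open>L \<ge> 0\<close> that h(2) by (simp add: A_def mult_nonneg_nonneg)
      ultimately show ?thesis
        using lin[of z t] that unfolding \<tau>_def by auto
    qed
    show "\<tau> 1 z \<le> a' - k\<^sup>2 * L" if "(c', a') \<in> {(c, a)}" "z \<in> ball c' (k * a')" for c' a' z
    proof -
      have z: "z \<in> ball c (k * a)" using that by simp
      have "k * a \<le> 1 * a" using k a by (intro mult_right_mono) auto
      with z have "z \<in> ball c a" unfolding mem_ball by linarith
      have "norm (z - c) \<le> k * a"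
        using z by (simp add: dist_norm norm_minus_commute)
      then have "(2 * L / a\<^sup>2) * h (norm (z - c)) \<ge> (2 * L / a\<^sup>2) * ((k * a)\<^sup>2 / 2)"
        using \<open>L \<ge> 0\<close> h(4) by (intro mult_left_mono) auto
      also have "(2 * L / a\<^sup>2) * ((k * a)\<^sup>2 / 2) = k\<^sup>2 * L"
        using a by (simp add: power_mult_distrib)
      finally have "1 * A * h (norm (z - c)) \<le> - (k\<^sup>2 * L)"
        by (simp add: A_def)
      then show ?thesis
        using lin[OF \<open>z \<in> ball c a\<close>, of 1] that unfolding \<tau>_def by auto
    qed
  qed
  then show ?thesis by blast
qed

text \<open>Each map preserves its own balls and is the identity on those of the other, so at every
  point at most one summand of the composite action is nonzero and the estimates carry over
  unchanged.\<close>

lemma ball_twists_insert: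
  assumes 1: "ball_twists k L {(c, a)} \<phi> \<sigma>" and F: "ball_twists k L F \<psi> \<tau>"
    and disj: "\<And>c' a'. (c', a') \<in> F \<Longrightarrow> ball c a \<inter> ball c' a' = {}"
    and k: "k \<le> 1" and pos: "\<And>c a. (c, a) \<in> F \<Longrightarrow> a > 0" "a > 0"
  shows "ball_twists k L (insert (c, a) F) (\<lambda>t z. \<psi> t (\<phi> t z)) (\<lambda>t z. \<sigma> t z + \<tau> t (\<phi> t z))"
proof -
  note D1 = ball_twistsD[OF 1] and DF = ball_twistsD[OF F]
  have out1: "\<phi> t z = z" "\<sigma> t z = 0" if "z \<notin> ball c a" for t z
    using that D1(2,3) by auto
  have in1: "\<phi> t z \<in> ball c a" if "z \<in> ball c a" for t z
    using that D1(4) by blast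
  have out2: "z \<notin> (\<Union>(c, a)\<in>F. ball c a)" if "z \<in> ball c a" for z
    using that disj by blast
  have in1': "\<psi> t (\<phi> t z) = \<phi> t z" "\<tau> t (\<phi> t z) = 0" if "z \<in> ball c a" for t z
    using DF(2,3)[OF out2[OF in1[OF that]]] by blast+
  have in2: "\<phi> t z = z" "\<sigma> t z = 0" if "(c', a') \<in> F" "z \<in> ball c' a'" for t z c' a'
    using that disj out1 by blast+
  have small: "z \<in> ball c' a'" if "z \<in> ball c' (k * a')" "a' > 0" for z c' a'
  proof -
    have "k * a' \<le> 1 * a'" using that k by (intro mult_right_mono) auto
    with that show ?thesis unfolding mem_ball by linarith
  qed
  show ?thesis
  proof (rule ball_twistsI)
    show "exact_isotopy (\<lambda>t z. \<psi> t (\<phi> t z)) (\<lambda>t z. \<sigma> t z + \<tau> t (\<phi> t z))"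
      by (rule exact_isotopy_compose[OF DF(1) D1(1)])
    show "\<psi> t (\<phi> t z) = z \<and> \<sigma> t z + \<tau> t (\<phi> t z) = 0"
      if "z \<notin> (\<Union>(c, a)\<in>insert (c, a) F. ball c a)" for t z
      using that out1[of z t] DF(2,3)[of z t] by auto
    show "\<psi> t (\<phi> t z) \<in> ball c' a'" if "(c', a') \<in> insert (c, a) F" "z \<in> ball c' a'" for t c' a' z
    proof (cases "(c', a') \<in> F")
      case True
      then show ?thesis using in2[OF True that(2)] DF(4)[OF True that(2)] by simp
    next
      case False
      then have "c' = c" "a' = a" using that by auto
      then show ?thesis using in1 in1' that by simp
    qed
    show "- L - a' \<le> \<sigma> t z + \<tau> t (\<phi> t z) \<and> \<sigma> t z + \<tau> t (\<phi> t z) \<le> a'"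
      if "(c', a') \<in> insert (c, a) F" "z \<in> ball c' a'" "0 \<le> t" "t \<le> 1" for t c' a' z
    proof (cases "(c', a') \<in> F")
      case True
      then show ?thesis using in2[OF True that(2), of t] DF(5,6)[OF True that(2,3,4)] by simp
    next
      case False
      then have "c' = c" "a' = a" using that by auto
      then show ?thesis using in1'(2)[of z t] D1(5,6)[of c a z t] that by simp
    qed
    show "\<sigma> 1 z + \<tau> 1 (\<phi> 1 z) \<le> a' - k\<^sup>2 * L"
      if "(c', a') \<in> insert (c, a) F" "z \<in> ball c' (k * a')" for c' a' z
    proof (cases "(c', a') \<in> F")
      case True
      then show ?thesis
        using in2[OF True small[OF that(2) pos(1)[OF True]], of 1] DF(7)[OF True that(2)] by simp
    next
      case False
      then have eq: "c' = c" "a' = a" using that by auto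
      then have "z \<in> ball c a" using small that pos(2) by blast
      then show ?thesis using in1'(2)[of z 1] D1(7)[of c a z] that(2) eq by simp
    qed
  qed
qed

lemma ball_twists_exists:
  fixes F :: "('n::finite phase \<times> real) set"
  assumes k: "0 < k" "k < 1" and "L \<ge> 0" and "r < 1" and "finite F"
    and "\<And>c a. (c, a) \<in> F \<Longrightarrow> 0 < a \<and> ball c a \<subseteq> ball 0 r"
    and "\<And>c a c' a'. (c, a) \<in> F \<Longrightarrow> (c', a') \<in> F \<Longrightarrow> (c, a) \<noteq> (c', a') \<Longrightarrow> ball c a \<inter> ball c' a' = {}"
  shows "\<exists>\<psi> \<tau>. ball_twists k L F \<psi> \<tau>"
  using assms(5,6,7)
proof (induction F rule: finite_induct)
  case empty
  have "ball_twists k L {} (\<lambda>t z :: 'n phase. z) (\<lambda>t z. 0)"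
    by (rule ball_twistsI) (simp_all add: exact_isotopy_id)
  then show ?case by blast
next
  case (insert x F)
  obtain c a where x: "x = (c, a)" by fastforce
  have "\<exists>\<psi> \<tau>. ball_twists k L F \<psi> \<tau>"
    by (rule insert.IH) (use insert.prems in blast)+
  then obtain \<psi> \<tau> where F: "ball_twists k L F \<psi> \<tau>" by blast
  have ca: "0 < a" "ball c a \<subseteq> ball 0 r" using insert.prems(1)[of c a] x by auto
  obtain \<phi> \<sigma> where 1: "ball_twists k L {(c, a)} \<phi> \<sigma>"
    using ball_twist_exists[OF k \<open>L \<ge> 0\<close> ca \<open>r < 1\<close>] by blast
  have "ball_twists k L (insert (c, a) F) (\<lambda>t z. \<psi> t (\<phi> t z)) (\<lambda>t z. \<sigma> t z + \<tau> t (\<phi> t z))"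
  proof (rule ball_twists_insert[OF 1 F])
    show "ball c a \<inter> ball c' a' = {}" if "(c', a') \<in> F" for c' a'
      using insert.prems(2)[of c a c' a'] insert.hyps(2) that x by auto
    show "a' > 0" if "(c', a') \<in> F" for c' a'
      using insert.prems(1)[of c' a'] that by blast
  qed (use k ca in auto)
  then show ?case unfolding x by blast
qed

section \<open>The global rotation and its composition with the ball twists\<close>

text \<open>Centred at the origin the off-centre term vanishes, so the action has the sign of the
  angle, here non-negative. It is at most 2 pi/n times b^2/2, hence at most pi/n.\<close>

lemma rotation_isotopy:
  assumes "n > 0" "0 < r" "r < 1"
  obtains \<rho> :: "real \<Rightarrow> 'n::finite phase \<Rightarrow> 'n phase" and \<sigma> and \<beta> :: "real \<Rightarrow> real"
  where "exact_isotopy \<rho> \<sigma>" "\<And>z. \<rho> 1 z = rot (\<beta> (norm z)) z" "\<And>t z. norm (\<rho> t z) = norm z"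
    "\<And>s. 0 \<le> \<beta> s" "\<And>s. \<beta> s \<le> 2 * pi / real n" "\<And>s. 0 \<le> s \<Longrightarrow> s \<le> r \<Longrightarrow> \<beta> s = 2 * pi / real n"
    "\<And>t z. 0 \<le> t \<Longrightarrow> 0 \<le> \<sigma> t z" "\<And>z. \<sigma> 1 z \<le> pi / real n"
proof -
  define \<alpha> where "\<alpha> = 2 * pi / real n"
  have \<alpha>: "\<alpha> \<ge> 0" by (simp add: \<alpha>_def)
  \<comment> \<open>A radius strictly between r and 1; with k = r/b the full angle is reached on all
    of the ball of radius r, which contains the packing.\<close>
  define b where "b = (1 + r) / 2"
  have b: "0 < b" "b < 1" "r < b" using assms by (auto simp: b_def)
  define k where "k = r / b"
  have k: "0 < k" "k < 1" "k * b = r"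
    using assms b by (auto simp: k_def)
  obtain u h where iso: "\<And>A. exact_isotopy (\<lambda>t z. 0 + rot (t * A * u (norm (z - 0))) (z - 0 :: 'n phase))
      (\<lambda>t z. t * A * h (norm (z - 0)) + cJ 0 \<bullet> (0 + rot (t * A * u (norm (z - 0))) (z - 0) - z) / 2)"
    and u: "\<And>s. 0 \<le> u s" "\<And>s. u s \<le> 1" "\<And>s. 0 \<le> s \<Longrightarrow> s \<le> k * b \<Longrightarrow> u s = 1" "\<And>s. s \<ge> b \<Longrightarrow> u s = 0"
    and h: "\<And>s. s \<ge> b \<Longrightarrow> h s = 0" "\<And>s. 0 \<le> h s" "\<And>s. h s \<le> b\<^sup>2 / 2"
    "\<And>s. 0 \<le> s \<Longrightarrow> s \<le> k * b \<Longrightarrow> h s \<ge> (k * b)\<^sup>2 / 2"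
    by (rule twist_isotopy[OF k(1,2) b(1) subset_refl b(2)]) (rule that)
  show ?thesis
  proof (rule that[of "\<lambda>t z. rot (t * \<alpha> * u (norm z)) z" "\<lambda>t z. t * \<alpha> * h (norm z)" "\<lambda>s. \<alpha> * u s"])
    show "exact_isotopy (\<lambda>t z. rot (t * \<alpha> * u (norm z)) z) (\<lambda>t z :: 'n phase. t * \<alpha> * h (norm z))"
      using iso[of \<alpha>] by (simp add: cJ_simps(4))
    show "\<alpha> * u s \<le> 2 * pi / real n" for s
      unfolding \<alpha>_def[symmetric] using \<alpha> u by (simp add: mult_left_le)
    show "\<alpha> * u s = 2 * pi / real n" if "0 \<le> s" "s \<le> r" for s
      unfolding \<alpha>_def[symmetric] using u(3) that k(3) by simp
    have "b\<^sup>2 \<le> 1" using b by (simp add: power_le_one)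
    show "1 * \<alpha> * h (norm z) \<le> pi / real n" for z :: "'n phase"
    proof -
      have "\<alpha> * h (norm z) \<le> \<alpha> * (1 / 2)"
        using \<alpha> h(3)[of "norm z"] \<open>b\<^sup>2 \<le> 1\<close> by (intro mult_left_mono) auto
      then show ?thesis by (simp add: \<alpha>_def)
    qed
  qed (use \<alpha> u h in auto)
qed

text \<open>The composite has action \<open>\<sigma>\<rho> t z + \<tau> t (\<rho> t z)\<close>. The
  first summand is non-negative for t >= 0, so only the twists lower the action; at fixed points the
  second summand vanishes. X is the union of the shrunken balls, which the rotation maps to shrunken
  balls, so that the strong upper bound on the twist action applies there.\<close>

lemma invariant_twist_construction:
  fixes L \<eta> e k :: real and n :: nat
  assumes "n \<ge> 2" "\<eta> > 0" "e > 0" "L \<ge> 0" "0 < k" "k < 1"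
  obtains \<phi> :: "real \<Rightarrow> 'n::finite phase \<Rightarrow> 'n phase" and \<sigma> X
  where "exact_isotopy \<phi> \<sigma>"
    "\<And>t z. 0 \<le> t \<Longrightarrow> t \<le> 1 \<Longrightarrow> \<sigma> t z \<ge> - L - \<eta>"
    "\<And>z. \<phi> 1 z = z \<Longrightarrow> \<sigma> 1 z \<ge> 0"
    "\<And>z j. j > 0 \<Longrightarrow> (\<phi> 1 ^^ j) z = z \<Longrightarrow> \<phi> 1 z \<noteq> z \<Longrightarrow> j \<ge> n"
    "\<And>z. \<sigma> 1 z \<le> pi / real n + \<eta>"
    "\<And>z. z \<in> X \<Longrightarrow> \<sigma> 1 z \<le> pi / real n + \<eta> - k\<^sup>2 * L"
    "X \<in> sets lborel" "X \<subseteq> ball 0 1"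
    "measure lborel X \<ge> k ^ (2 * CARD('n)) * (measure lborel (ball 0 1 :: 'n phase set) - e)"
proof -
  define \<alpha> where "\<alpha> = 2 * pi / real n"
  have n\<alpha>: "real n * \<alpha> = 2 * pi" and \<alpha>: "\<alpha> > 0"
    using assms(1) by (simp_all add: \<alpha>_def)
  have "n > 0" using assms(1) by simp
  obtain F :: "('n phase \<times> real) set" and r where F: "finite F" "0 < r" "r < 1"
    "\<And>c a. (c, a) \<in> F \<Longrightarrow> 0 < a \<and> a \<le> \<eta> \<and> ball c a \<subseteq> ball 0 r \<and> c \<noteq> 0"
    and rotF: "\<And>c a. (c, a) \<in> F \<Longrightarrow> (rot \<alpha> c, a) \<in> F" "\<And>c a. (c, a) \<in> F \<Longrightarrow> (rot (- \<alpha>) c, a) \<in> F"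
    and disj: "\<And>c a c' a'. (c, a) \<in> F \<Longrightarrow> (c', a') \<in> F \<Longrightarrow> (c, a) \<noteq> (c', a') \<Longrightarrow> ball c a \<inter> ball c' a' = {}"
    and vol: "measure lebesgue (\<Union>(c, a)\<in>F. ball c a) > measure lebesgue (ball 0 1 :: 'n phase set) - e"
    by (rule rotation_invariant_ball_packing[OF \<open>n > 0\<close> assms(2,3), folded \<alpha>_def]) (rule that)
  obtain \<rho> :: "real \<Rightarrow> 'n phase \<Rightarrow> 'n phase" and \<sigma>\<rho> and \<beta> :: "real \<Rightarrow> real"
    where \<rho>: "exact_isotopy \<rho> \<sigma>\<rho>" "\<And>z. \<rho> 1 z = rot (\<beta> (norm z)) z" "\<And>t z. norm (\<rho> t z) = norm z"
    and \<beta>: "\<And>s. 0 \<le> \<beta> s" "\<And>s. \<beta> s \<le> \<alpha>" "\<And>s. 0 \<le> s \<Longrightarrow> s \<le> r \<Longrightarrow> \<beta> s = \<alpha>"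
    and \<sigma>\<rho>: "\<And>t z. 0 \<le> t \<Longrightarrow> 0 \<le> \<sigma>\<rho> t z" "\<And>z. \<sigma>\<rho> 1 z \<le> pi / real n"
    by (rule rotation_isotopy[OF \<open>n > 0\<close> F(2,3), folded \<alpha>_def]) (rule that)
  obtain \<psi> \<tau> where T: "ball_twists k L F \<psi> \<tau>"
    using ball_twists_exists[OF assms(5,6,4) F(3,1) _ disj] F(4) by blast
  note T = ball_twistsD[OF T]
  define U where "U = (\<Union>(c, a)\<in>F. ball c a)"
  have \<tau>_bounds: "- L - \<eta> \<le> \<tau> t z" "\<tau> t z \<le> \<eta>" if "0 \<le> t" "t \<le> 1" for t z
  proof -
    have "- L - \<eta> \<le> \<tau> t z \<and> \<tau> t z \<le> \<eta>"
    proof (cases "z \<in> U")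
      case True
      then obtain c a where ca: "(c, a) \<in> F" "z \<in> ball c a" unfolding U_def by blast
      show ?thesis using T(5,6)[OF ca that] F(4)[OF ca(1)] by linarith
    next
      case False
      then show ?thesis using T(3)[of z t] assms unfolding U_def by simp
    qed
    then show "- L - \<eta> \<le> \<tau> t z" "\<tau> t z \<le> \<eta>" by auto
  qed
  define f where "f = (\<lambda>z. \<psi> 1 (\<rho> 1 z))"
  have \<rho>_ball: "\<rho> 1 z \<in> ball (rot \<alpha> c) b" if "(c, a) \<in> F" "b \<le> a" "z \<in> ball c b" for c a b z
  proof -
    have "z \<in> ball c a" using that(2,3) by simp
    then have "z \<in> ball 0 r" using F(4)[OF that(1)] by blast
    then have "\<rho> 1 z = rot \<alpha> z" by (simp add: \<rho>(2) \<beta>(3))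
    then show ?thesis using that by simp
  qed
  have f_ball: "f z \<in> ball (rot \<alpha> c) a" if "(c, a) \<in> F" "z \<in> ball c a" for c a z
    unfolding f_def using T(4)[OF rotF(1)[OF that(1)]] \<rho>_ball[OF that(1) order_refl that(2)] by blast
  have iter_ball: "(f ^^ j) z \<in> ball (rot (real j * \<alpha>) c) a \<and> (rot (real j * \<alpha>) c, a) \<in> F"
    if "(c, a) \<in> F" "z \<in> ball c a" for c a z j
  proof (induction j)
    case 0
    then show ?case using that by simp
  next
    case (Suc j)
    have eq: "rot (real (Suc j) * \<alpha>) c = rot \<alpha> (rot (real j * \<alpha>) c)"
      by (simp add: rot_add algebra_simps)
    show ?case
      unfolding eq using f_ball[of "rot (real j * \<alpha>) c" a] rotF(1) Suc by simp
  qed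
  \<comment> \<open>A returning point puts it into both its ball and the rotated ball. Disjointness
    makes the centre fixed under the j-fold rotation, and as the centre is nonzero, j alpha is a
    multiple of 2 pi; for 0 < j < n it lies strictly between 0 and 2 pi.\<close>
  have per_ball: "j \<ge> n" if zU: "z \<in> U" and "j > 0" and fj: "(f ^^ j) z = z" for z j
  proof (rule ccontr)
    assume "\<not> j \<ge> n"
    obtain c a where ca: "(c, a) \<in> F" "z \<in> ball c a" using zU unfolding U_def by blast
    note it = iter_ball[OF ca, of j]
    have "rot (real j * \<alpha>) c = c"
    proof (rule ccontr)
      assume "rot (real j * \<alpha>) c \<noteq> c"
      then have "ball (rot (real j * \<alpha>) c) a \<inter> ball c a = {}"
        using disj it ca by blast
      then show False using it ca fj by auto
    qed
    then obtain q :: int where q: "real j * \<alpha> = 2 * pi * of_int q"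
      using F(4)[OF ca(1)] unfolding rot_eq_self_iff by blast
    have "0 < real j * \<alpha>" using \<open>j > 0\<close> \<alpha> by simp
    moreover have "real j * \<alpha> < real n * \<alpha>" using \<open>\<not> j \<ge> n\<close> \<alpha> by simp
    ultimately have "0 < 2 * pi * of_int q" "2 * pi * of_int q < 2 * pi * 1"
      unfolding q n\<alpha> by simp_all
    then have "0 < q" "q < 1" by (simp_all add: zero_less_mult_iff)
    then show False by simp
  qed
  \<comment> \<open>\<open>\<rho> 1\<close> preserves the norm, so z lies in the ball of radius r as
    well and is turned by exactly alpha; invariance of the packing under the inverse rotation puts z
    in U.\<close>
  have out: "\<rho> 1 z \<notin> U" if "z \<notin> U" for z
  proof
    assume "\<rho> 1 z \<in> U"
    then obtain c a where ca: "(c, a) \<in> F" "\<rho> 1 z \<in> ball c a" unfolding U_def by blast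
    then have "\<rho> 1 z \<in> ball 0 r" using F(4) by blast
    then have "\<rho> 1 z = rot \<alpha> z" using \<rho>(3)[of 1 z] by (simp add: \<rho>(2) \<beta>(3))
    then have "z \<in> ball (rot (- \<alpha>) c) a"
      using ca(2) mem_ball_rot[of \<alpha> z "rot (- \<alpha>) c" a] by (simp add: rot_add)
    then show False using rotF(2)[OF ca(1)] that unfolding U_def by blast
  qed
  have f_out: "f z = rot (\<beta> (norm z)) z" "f z \<notin> U" if "z \<notin> U" for z
    using out[OF that] T(2)[of "\<rho> 1 z" 1] \<rho>(2) unfolding f_def U_def by simp_all
  have iter_out: "(f ^^ j) z = rot (real j * \<beta> (norm z)) z \<and> (f ^^ j) z \<notin> U" if "z \<notin> U" for z j
  proof (induction j)
    case 0
    then show ?case using that by simp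
  next
    case (Suc j)
    then have "f ((f ^^ j) z) = rot (\<beta> (norm z)) ((f ^^ j) z)" "f ((f ^^ j) z) \<notin> U"
      using f_out[of "(f ^^ j) z"] by auto
    then show ?case using Suc by (simp add: rot_add algebra_simps)
  qed
  have per: "j \<ge> n" if "j > 0" "(f ^^ j) z = z" "f z \<noteq> z" for z j
  proof (cases "z \<in> U")
    case False
    have "z \<noteq> 0" "\<beta> (norm z) \<noteq> 0" using f_out(1)[OF False] that(3) by (auto simp: rot_simps(4))
    then have pos: "\<beta> (norm z) > 0" using \<beta>(1)[of "norm z"] by simp
    have "rot (real j * \<beta> (norm z)) z = z" using iter_out[OF False, of j] that by simp
    then obtain q :: int where q: "real j * \<beta> (norm z) = 2 * pi * of_int q"
      using \<open>z \<noteq> 0\<close> unfolding rot_eq_self_iff by blast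
    have "0 < 2 * pi * of_int q" unfolding q[symmetric] using pos that by simp
    \<comment> \<open>A point off the balls must complete at least one full turn, and each iteration
      turns it by at most alpha = 2 pi/n.\<close>
    then have "q \<ge> 1" by (simp add: zero_less_mult_iff)
    then have "2 * pi * 1 \<le> 2 * pi * real_of_int q" by (intro mult_left_mono) auto
    also have "\<dots> \<le> real j * \<alpha>" unfolding q[symmetric] using \<beta>(2) by (intro mult_left_mono) auto
    finally have "real n * \<alpha> \<le> real j * \<alpha>" unfolding n\<alpha> by simp
    then show ?thesis using \<alpha> by simp
  qed (use per_ball that in blast)
  define X where "X = (\<Union>x\<in>F. ball (fst x) (k * snd x))"
  show ?thesis
  proof (rule that)
    show "exact_isotopy (\<lambda>t z. \<psi> t (\<rho> t z)) (\<lambda>t z. \<sigma>\<rho> t z + \<tau> t (\<rho> t z))"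
      by (rule exact_isotopy_compose[OF T(1) \<rho>(1)])
    show "\<sigma>\<rho> t z + \<tau> t (\<rho> t z) \<ge> - L - \<eta>" if "0 \<le> t" "t \<le> 1" for t z
      using \<sigma>\<rho>(1)[OF that(1), of z] \<tau>_bounds(1)[OF that, of "\<rho> t z"] by linarith
    show "\<sigma>\<rho> 1 z + \<tau> 1 (\<rho> 1 z) \<ge> 0" if fz: "\<psi> 1 (\<rho> 1 z) = z" for z
    proof -
      \<comment> \<open>A fixed point in U would have return time 1 >= n; this is where n >= 2
        enters.\<close>
      have "z \<notin> U" using per_ball[of z 1] fz assms(1) unfolding f_def by auto
      then show ?thesis using out[of z] T(3)[of "\<rho> 1 z" 1] \<sigma>\<rho>(1)[of 1 z] unfolding U_def by simp
    qed
    show "j \<ge> n" if "j > 0" "((\<lambda>z. \<psi> 1 (\<rho> 1 z)) ^^ j) z = z" "\<psi> 1 (\<rho> 1 z) \<noteq> z" for z j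
      using per that unfolding f_def by blast
    show "\<sigma>\<rho> 1 z + \<tau> 1 (\<rho> 1 z) \<le> pi / real n + \<eta>" for z
      using \<sigma>\<rho>(2)[of z] \<tau>_bounds(2)[of 1 "\<rho> 1 z"] by simp
    show "\<sigma>\<rho> 1 z + \<tau> 1 (\<rho> 1 z) \<le> pi / real n + \<eta> - k\<^sup>2 * L" if zX: "z \<in> X" for z
    proof -
      obtain c a where ca: "(c, a) \<in> F" "z \<in> ball c (k * a)"
        using zX unfolding X_def by auto
      have "k * a \<le> a" using F(4)[OF ca(1)] assms by (simp add: mult_left_le_one_le)
      from \<rho>_ball[OF ca(1) this ca(2)] T(7)[OF rotF(1)[OF ca(1)]]
      have "\<tau> 1 (\<rho> 1 z) \<le> a - k\<^sup>2 * L" by blast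
      then show ?thesis using \<sigma>\<rho>(2)[of z] F(4)[OF ca(1)] by linarith
    qed
    show "X \<in> sets lborel" unfolding X_def by (auto intro!: borel_open open_UN)
    have small: "ball (fst x) (k * snd x) \<subseteq> ball (fst x) (snd x)" if "x \<in> F" for x
      using F(4)[of "fst x" "snd x"] that assms by (intro subset_ball) (simp add: mult_left_le_one_le)
    show "X \<subseteq> ball 0 1"
    proof -
      have "ball (fst x) (snd x) \<subseteq> ball 0 1" if "x \<in> F" for x
        using F(4)[of "fst x" "snd x"] subset_ball[of r 1 "0 :: 'n phase"] F(3) that by simp blast
      then show ?thesis unfolding X_def using small by blast
    qed
    have pw: "pairwise (\<lambda>x y. disjnt (ball (fst x) (snd x)) (ball (fst y) (snd y))) F"
      using disj unfolding pairwise_def disjnt_def by (metis prod.collapse)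
    have pw': "pairwise (\<lambda>x y. disjnt (ball (fst x) (k * snd x)) (ball (fst y) (k * snd y))) F"
      using pw small unfolding pairwise_def by (meson disjnt_subset1 disjnt_subset2)
    have fm: "ball c a \<in> fmeasurable lborel" for c :: "'n phase" and a
      using emeasure_lborel_ball_finite[of c a] by (intro fmeasurableI) simp_all
    have "measure lborel X = (\<Sum>x\<in>F. measure lborel (ball (fst x) (k * snd x)))"
      unfolding X_def by (rule measure_UNION'[OF F(1) fm pw'])
    have dim: "DIM('n phase) = 2 * CARD('n)" by simp
    note \<open>measure lborel X = _\<close>
    also have "(\<Sum>x\<in>F. measure lborel (ball (fst x) (k * snd x))) = (\<Sum>x\<in>F. k ^ (2 * CARD('n)) * measure lborel (ball (fst x) (snd x)))"
    proof (rule sum.cong)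
      fix x assume "x \<in> F"
      then have "snd x > 0" using F(4)[of "fst x" "snd x"] by simp
      then show "measure lborel (ball (fst x) (k * snd x)) =
          k ^ (2 * CARD('n)) * measure lborel (ball (fst x) (snd x))"
        using assms dim by (simp only: content_ball power_mult_distrib mult_nonneg_nonneg less_imp_le) simp
    qed simp
    also have "\<dots> = k ^ (2 * CARD('n)) * measure lborel (\<Union>x\<in>F. ball (fst x) (snd x))"
      unfolding sum_distrib_left[symmetric] measure_UNION'[OF F(1) fm pw] ..
    finally have eq: "measure lborel X = k ^ (2 * CARD('n)) * measure lborel (\<Union>x\<in>F. ball (fst x) (snd x))" .
    have "open (\<Union>x\<in>F. ball (fst x) (snd x))" by blast
    then have "measure lborel (\<Union>x\<in>F. ball (fst x) (snd x)) \<ge> measure lborel (ball 0 1 :: 'n phase set) - e"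
      using vol by (simp add: case_prod_unfold)
    then show "measure lborel X \<ge> k ^ (2 * CARD('n)) * (measure lborel (ball 0 1 :: 'n phase set) - e)"
      unfolding eq using assms by (intro mult_left_mono) auto
  qed
qed

section \<open>Estimate of the Calabi invariant and choice of the parameters\<close>

text \<open>The integrand is bounded by C on the ball, reduced by D on X. Integrability comes from
  continuity on the compact closed ball, and the factor m! is the value of omega^m on the coordinate
  frame.\<close>

lemma CAL_le:
  fixes \<phi> :: "real \<Rightarrow> 'n::finite phase \<Rightarrow> 'n phase"
  assumes iso: "exact_isotopy \<phi> \<sigma>" and X: "X \<in> sets lborel" "X \<subseteq> ball 0 1"
    and "\<And>z. \<sigma> t z \<le> C" "\<And>z. z \<in> X \<Longrightarrow> \<sigma> t z \<le> C - D"
  shows "CAL (\<phi> t) \<le> fact CARD('n) * (C * measure lborel (ball 0 1 :: 'n phase set) - D * measure lborel X)"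
proof -
  have "set_integrable lborel (cball 0 1) (\<sigma> t)"
    unfolding set_integrable_def
    by (rule borel_integrable_compact[OF compact_cball exact_isotopy_action_continuous[OF iso]])
  then have int: "set_integrable lborel (ball 0 1) (\<sigma> t)"
    by (rule set_integrable_subset) auto
  have "emeasure lborel X \<le> emeasure lborel (ball 0 1 :: 'n phase set)"
    using X by (intro emeasure_mono) auto
  then have fin: "emeasure lborel X < \<infinity>"
    using emeasure_lborel_ball_finite by (metis infinity_ennreal_def order_le_less_trans)
  have finB: "emeasure lborel (ball 0 1 :: 'n phase set) < \<infinity>"
    using emeasure_lborel_ball_finite by simp
  have intX: "integrable lborel (\<lambda>z. indicator X z * D :: real)"
    and intB: "integrable lborel (\<lambda>z. indicator (ball 0 1 :: 'n phase set) z * C :: real)"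
    using fin finB X by (auto intro!: integrable_mult_left integrable_real_indicator)
  have "(LINT z:ball 0 1|lborel. \<sigma> t z) \<le>
      (LINT z|lborel. indicator (ball 0 1) z * C - indicator X z * D)"
    unfolding set_lebesgue_integral_def
  proof (rule integral_mono)
    show "integrable lborel (\<lambda>z. indicator (ball 0 1) z *\<^sub>R \<sigma> t z)"
      using int unfolding set_integrable_def .
    show "integrable lborel (\<lambda>z. indicator (ball 0 1) z * C - indicator X z * D)"
      by (rule Bochner_Integration.integrable_diff[OF intB intX])
    show "indicator (ball 0 1) z *\<^sub>R \<sigma> t z \<le> indicator (ball 0 1) z * C - indicator X z * D" for z
      using assms(4)[of z] assms(5)[of z] X(2) by (auto simp: indicator_def)
  qed
  also have "\<dots> = C * measure lborel (ball 0 1 :: 'n phase set) - D * measure lborel X"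
    using Bochner_Integration.integral_diff[OF intB intX] X by simp
  finally have le: "(LINT z:ball 0 1|lborel. \<sigma> t z) \<le>
      C * measure lborel (ball 0 1 :: 'n phase set) - D * measure lborel X" .
  have "CAL (\<phi> t) = fact CARD('n) * (LINT z:ball 0 1|lborel. \<sigma> t z)"
    unfolding CAL_def exact_isotopy_action[OF iso] symplectic_volume_form_coordinate_frame
    by simp
  then show ?thesis
    using le by (simp add: mult_left_mono)
qed

text \<open>The denominator m! cancels the factor m! of omega^m, which is how the constant L pi^m
  arises.\<close>

lemma measure_phase_unit_ball:
  "measure lborel (ball 0 1 :: 'n::finite phase set) = pi ^ CARD('n) / fact CARD('n)"
proof -
  have "DIM('n phase) = 2 * CARD('n)" by simp
  then show ?thesis
    using content_ball[of 1 "0 :: 'n phase"] unit_ball_vol_even[of "CARD('n)"]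
    by (simp only: zero_le_one power_one mult_1_right simp_thms)
qed

theorem lemma3p1:
  fixes L \<epsilon> :: real
  assumes "CARD('n::finite) \<ge> 2" and "L > 0" and "\<epsilon> > 0"
  shows "\<exists>(n::nat) (\<phi> :: real \<Rightarrow> 'n phase \<Rightarrow> 'n phase).
           n > 0
           \<and> compactly_supported_isotopy \<phi>
           \<and> (\<forall>z\<in>unit_ball. \<phi> 0 z = z)
           \<and> (\<forall>t\<in>{0..1}. \<forall>z\<in>unit_ball. action (\<phi> t) z \<ge> - L + L / real n)
           \<and> CAL (\<phi> 1) + L * pi ^ CARD('n) \<le> \<epsilon>
           \<and> (\<forall>z\<in>unit_ball. \<phi> 1 z = z \<longrightarrow> action (\<phi> 1) z \<ge> 0)
           \<and> (\<forall>z\<in>unit_ball. periodic_point (\<phi> 1) z \<and> \<phi> 1 z \<noteq> z \<longrightarrow> least_power (\<phi> 1) z \<ge> n)"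
proof -
  define m where "m = CARD('n)"
  define V where "V = pi ^ m / fact m"
  \<comment> \<open>With x = 1/n this solves -L' - x = -L + L/n: twists built for L' with action
    error at most x satisfy (b1) exactly.\<close>
  define L' where "L' = (\<lambda>x. L - L * x - x)"
  \<comment> \<open>The Calabi bound when all small parameters are tied to x = 1/n, namely \<eta> =
    e = x and k = 1 - x. As x tends to 0 it tends to -m! V L = -L pi^m, so a large n gives
    (b2).\<close>
  define G where "G = (\<lambda>x. fact m * ((pi * x + x) * V - (1 - x)\<^sup>2 * L' x * ((1 - x) ^ (2 * m) * (V - x))))"
  have lim: "(\<lambda>n. 1 / real n) \<longlonglongrightarrow> 0" by (rule lim_1_over_n)
  have "(\<lambda>n. G (1 / real n)) \<longlonglongrightarrow> fact m * ((pi * 0 + 0) * V - (1 - 0)\<^sup>2 * (L - L * 0 - 0) * ((1 - 0) ^ (2 * m) * (V - 0)))"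
    unfolding G_def L'_def by (intro tendsto_intros lim)
  then have "(\<lambda>n. G (1 / real n)) \<longlonglongrightarrow> - (L * pi ^ m)"
    by (simp add: V_def)
  then have ev1: "eventually (\<lambda>n. G (1 / real n) < - (L * pi ^ m) + \<epsilon>) sequentially"
    using assms(3) by (intro order_tendstoD(2)) auto
  have "(\<lambda>n. L' (1 / real n)) \<longlonglongrightarrow> L - L * 0 - 0"
    unfolding L'_def by (intro tendsto_intros lim)
  then have ev2: "eventually (\<lambda>n. L' (1 / real n) > 0) sequentially"
    using assms(2) by (intro order_tendstoD(1)) auto
  obtain n where n: "n \<ge> 2" "G (1 / real n) < - (L * pi ^ m) + \<epsilon>" "L' (1 / real n) > 0"
    using eventually_happens[OF eventually_conj[OF eventually_ge_at_top[of 2] eventually_conj[OF ev1 ev2]]]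
    by auto
  define x where "x = 1 / real n"
  have x: "0 < x" "0 < 1 - x" "1 - x < 1" "L' x \<ge> 0" using n by (simp_all add: x_def)
  obtain \<phi> :: "real \<Rightarrow> 'n phase \<Rightarrow> 'n phase" and \<sigma> X where iso: "exact_isotopy \<phi> \<sigma>"
    and low: "\<And>t z. 0 \<le> t \<Longrightarrow> t \<le> 1 \<Longrightarrow> \<sigma> t z \<ge> - L' x - x"
    and fixed: "\<And>z. \<phi> 1 z = z \<Longrightarrow> \<sigma> 1 z \<ge> 0"
    and per: "\<And>z j. j > 0 \<Longrightarrow> (\<phi> 1 ^^ j) z = z \<Longrightarrow> \<phi> 1 z \<noteq> z \<Longrightarrow> j \<ge> n"
    and up: "\<And>z. \<sigma> 1 z \<le> pi / real n + x"
      "\<And>z. z \<in> X \<Longrightarrow> \<sigma> 1 z \<le> pi / real n + x - (1 - x)\<^sup>2 * L' x"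
    and X: "X \<in> sets lborel" "X \<subseteq> ball 0 1"
    and vol: "measure lborel X \<ge> (1 - x) ^ (2 * CARD('n)) * (measure lborel (ball 0 1 :: 'n phase set) - x)"
    by (rule invariant_twist_construction[OF n(1) x(1) x(1) x(4) x(2) x(3)]) (rule that)
  note act = exact_isotopy_action[OF iso]
  have V: "measure lborel (ball 0 1 :: 'n phase set) = V"
    unfolding V_def m_def by (rule measure_phase_unit_ball)
  have "CAL (\<phi> 1) \<le> fact m * ((pi / real n + x) * V - (1 - x)\<^sup>2 * L' x * measure lborel X)"
    using CAL_le[OF iso X up] unfolding V m_def .
  also have "\<dots> \<le> fact m * ((pi / real n + x) * V - (1 - x)\<^sup>2 * L' x * ((1 - x) ^ (2 * m) * (V - x)))"
    using vol x(4) unfolding V m_def[symmetric] by (intro mult_left_mono diff_left_mono) auto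
  also have "\<dots> = G x"
    by (simp add: G_def x_def)
  finally have cal: "CAL (\<phi> 1) + L * pi ^ CARD('n) \<le> \<epsilon>"
    using n(2) unfolding x_def m_def by simp
  have "action (\<phi> t) z \<ge> - L + L / real n" if "0 \<le> t" "t \<le> 1" for t z
    using low[OF that, of z] unfolding act by (simp add: L'_def x_def)
  moreover have "least_power (\<phi> 1) z \<ge> n" if z: "periodic_point (\<phi> 1) z" "\<phi> 1 z \<noteq> z" for z
  proof -
    obtain j where "0 < j \<and> (\<phi> 1 ^^ j) z = z"
      using z(1) unfolding periodic_point_def ..
    then have "(\<phi> 1 ^^ j) z = z \<and> j > 0" by simp
    then have "(\<phi> 1 ^^ least_power (\<phi> 1) z) z = z \<and> least_power (\<phi> 1) z > 0"
      unfolding least_power_def by (rule LeastI)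
    then show ?thesis
      using per[of "least_power (\<phi> 1) z" z] z(2) by simp
  qed
  ultimately show ?thesis
    using n(1) exact_isotopy_compactly_supported[OF iso] exact_isotopy_0[OF iso] cal
      fixed[folded act]
    by (intro exI[of _ n] exI[of _ \<phi>] conjI ballI impI) (simp_all only: atLeastAtMost_iff, simp)
qed

end
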